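(* Let $\Theta$ be a first-order signature. For every set $\Gamma\cup\{\varphi\}\subseteq For(\Theta)$: $\Gamma\vdash_{\mathbf{QLFI1}_\circ}\varphi$ if and only if $\Gamma\models_{(\mathfrak A,\mathcal M_{LFI1})}\varphi$ for every structure $\mathfrak A$ over $\Theta$ and $\mathcal M_{LFI1}$.
   Context: **Language.** $Var$ is a denumerable set of individual variables. A first-order signature $\Theta$ consists of a set of individual constants and, for each $n\ge 1$, sets of function and predicate symbols of arity $n$ (with at least one predicate symbol). Formulas are built with binary connectives $\wedge,\vee,\to$, unary connectives $\neg,\circ$, and quantifiers $\forall,\exists$. $For(\Theta)$, $Sen(\Theta)$ are the sets of formulas and sentences. $\varphi[x/t]$ is the result of replacing every free occurrence of $x$ in $\varphi$ by $t$. $\alpha\leftrightarrow\beta$ abbreviates $(\alpha\to\beta)\wedge(\beta\to\alpha)$. **Calculus $\mathbf{QLFI1}_\circ$** (Hilbert calculus over $For(\Theta)$). Axiom schemas: (A1) $\alpha\to(\beta\to\alpha)$; (A2) $(\alpha\to(\beta\to\gamma))\to((\alpha\to\beta)\to(\alpha\to\gamma))$; (A3) $\alpha\to(\beta\to(\alpha\wedge\beta))$; (A4) $(\alpha\wedge\beta)\to\alpha$; (A5) $(\alpha\wedge\beta)\to\beta$; (A6) $\alpha\to(\alpha\vee\beta)$; (A7) $\beta\to(\alpha\vee\beta)$; (A8) $(\alpha\to\gamma)\to((\beta\to\gamma)\to((\alpha\vee\beta)\to\gamma))$; (A9) $\alpha\vee(\alpha\to\beta)$; (A10) $\alpha\vee\neg\alpha$;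 (A11) $\circ\alpha\to(\alpha\to(\neg\alpha\to\beta))$; (ci) $\neg\circ\alpha\to(\alpha\wedge\neg\alpha)$; (dneg) $\neg\neg\alpha\leftrightarrow\alpha$; (neg$\vee$) $\neg(\alpha\vee\beta)\leftrightarrow(\neg\alpha\wedge\neg\beta)$; (neg$\wedge$) $\neg(\alpha\wedge\beta)\leftrightarrow(\neg\alpha\vee\neg\beta)$; (neg$\to$) $\neg(\alpha\to\beta)\leftrightarrow(\alpha\wedge\neg\beta)$; (Ax12) $\varphi[x/t]\to\exists x\varphi$ if $t$ is free for $x$ in $\varphi$; (Ax13) $\forall x\varphi\to\varphi[x/t]$ if $t$ is free for $x$ in $\varphi$; (Ax$\neg\exists$) $\neg\exists x\varphi\leftrightarrow\forall x\neg\varphi$; (Ax$\neg\forall$) $\neg\forall x\varphi\leftrightarrow\exists x\neg\varphi$. Rules: (MP) from $\alpha$, $\alpha\to\beta$ infer $\beta$; ($\exists$-In) from $\varphi\to\psi$ infer $\exists x\varphi\to\psi$ if $x$ is not free in $\psi$; ($\forall$-In) from $\varphi\to\psi$ infer $\varphi\to\forall x\psi$ if $x$ is not free in $\varphi$. $\Gamma\vdash_{\mathbf{QLFI1}_\circ}\varphi$ means there is a finite derivation of $\varphi$ whose steps are axiom instances, members of $\Gamma$, or follow from earlier steps by a rule. **The matrix $\mathcal M_{LFI1}$.** It is the logical matrix with domain $M=\{1,\frac12,0\}$ (with the usual order), designated values $\{1,\frac12\}$, and operations: $x\wedge y=\min(x,y)$; $x\vee y=\max(x,y)$; $x\to y=y$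 if $x\in\{1,\frac12\}$ and $0\to y=1$; $\neg x=1-x$; $\circ 1=\circ 0=1$ and $\circ\frac12=0$. **Structures and interpretation.** A structure $\mathfrak A=\langle U,I_{\mathfrak A}\rangle$ over $\Theta$ and $\mathcal M_{LFI1}$ has a nonempty domain $U$ and assigns $c^{\mathfrak A}\in U$ to constants, $f^{\mathfrak A}:U^n\to U$ to $n$-ary function symbols, $P^{\mathfrak A}:U^n\to M$ to $n$-ary predicate symbols. $\Theta_U$ is $\Theta$ plus a new constant $\bar a$ (interpreted as $a$) for each $a\in U$. The interpretation map $[\![\cdot]\!]^{\mathfrak A}:Sen(\Theta_U)\to M$ is defined by: $[\![P(t_1,\dots,t_n)]\!]^{\mathfrak A}=P^{\mathfrak A}(a_1,\dots,a_n)$, where $a_i$ is the value of the closed term $t_i$; connectives are interpreted by the operations of $\mathcal M_{LFI1}$; and, with $X=\{[\![\varphi[x/\bar a]]\!]^{\mathfrak A}: a\in U\}$, $[\![\forall x\varphi]\!]^{\mathfrak A}=\min X$ and $[\![\exists x\varphi]\!]^{\mathfrak A}=\max X$. For an assignment $\mu:Var\to U$, $[\![\varphi]\!]^{\mathfrak A}_\mu=[\![\widehat\mu(\varphi)]\!]^{\mathfrak A}$, where $\widehat\mu(\varphi)$ replaces each free variable $x$ of $\varphi$ by $\overline{\mu(x)}$. **Consequence.** $\Gamma\models_{(\mathfrak A,\mathcal M_{LFI1})}\varphi$ iff: if $[\![\gamma]\!]^{\mathfrak A}_\mu\in\{1,\frac12\}$ for all $\gamma\in\Gamma$ and all $\mu$,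 then $[\![\varphi]\!]^{\mathfrak A}_\mu\in\{1,\frac12\}$ for all $\mu$. *)

theory Defs
  imports Main
begin

section \<open>Language\<close>

text \<open>Individual variables are natural numbers.  A signature consists of subsets of the types
  \<open>'c\<close>, \<open>'f\<close>, \<open>'p\<close>, so it may have any cardinality.  Only the values of
  \<open>fun_syms\<close> and \<open>pred_syms\<close> at arities \<open>n \<ge> 1\<close> are relevant.  Nothing
  forbids a symbol from occurring at several arities: its occurrences are told apart by the
  lengths of their argument lists.\<close>

record ('c, 'f, 'p) signature =
  const_syms :: "'c set"
  fun_syms :: "nat \<Rightarrow> 'f set"
  pred_syms :: "nat \<Rightarrow> 'p set"

definition is_signature :: "('c, 'f, 'p) signature \<Rightarrow> bool" where
  "is_signature \<Theta> \<longleftrightarrow> (\<exists>n\<ge>1. pred_syms \<Theta> n \<noteq> {})"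

datatype ('c, 'f) tm =
  Var nat
| Const 'c
| Fun 'f "('c, 'f) tm list"

datatype ('c, 'f, 'p) fm =
  Pred 'p "('c, 'f) tm list"
| And "('c, 'f, 'p) fm" "('c, 'f, 'p) fm"
| Or "('c, 'f, 'p) fm" "('c, 'f, 'p) fm"
| Imp "('c, 'f, 'p) fm" "('c, 'f, 'p) fm"
| Neg "('c, 'f, 'p) fm"
| Circ "('c, 'f, 'p) fm"
| All nat "('c, 'f, 'p) fm"
| Ex nat "('c, 'f, 'p) fm"

abbreviation Iff :: "('c, 'f, 'p) fm \<Rightarrow> ('c, 'f, 'p) fm \<Rightarrow> ('c, 'f, 'p) fm" where
  "Iff \<alpha> \<beta> \<equiv> And (Imp \<alpha> \<beta>) (Imp \<beta> \<alpha>)"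

primrec tm_over :: "('c, 'f, 'p) signature \<Rightarrow> ('c, 'f) tm \<Rightarrow> bool" where
  "tm_over \<Theta> (Var x) \<longleftrightarrow> True"
| "tm_over \<Theta> (Const c) \<longleftrightarrow> c \<in> const_syms \<Theta>"
| "tm_over \<Theta> (Fun f ts) \<longleftrightarrow>
     ts \<noteq> [] \<and> f \<in> fun_syms \<Theta> (length ts) \<and> list_all (tm_over \<Theta>) ts"

primrec fm_over :: "('c, 'f, 'p) signature \<Rightarrow> ('c, 'f, 'p) fm \<Rightarrow> bool" where
  "fm_over \<Theta> (Pred P ts) \<longleftrightarrow>
     ts \<noteq> [] \<and> P \<in> pred_syms \<Theta> (length ts) \<and> list_all (tm_over \<Theta>) ts"
| "fm_over \<Theta> (And \<alpha> \<beta>) \<longleftrightarrow> fm_over \<Theta> \<alpha> \<and> fm_over \<Theta> \<beta>"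
| "fm_over \<Theta> (Or \<alpha> \<beta>) \<longleftrightarrow> fm_over \<Theta> \<alpha> \<and> fm_over \<Theta> \<beta>"
| "fm_over \<Theta> (Imp \<alpha> \<beta>) \<longleftrightarrow> fm_over \<Theta> \<alpha> \<and> fm_over \<Theta> \<beta>"
| "fm_over \<Theta> (Neg \<alpha>) \<longleftrightarrow> fm_over \<Theta> \<alpha>"
| "fm_over \<Theta> (Circ \<alpha>) \<longleftrightarrow> fm_over \<Theta> \<alpha>"
| "fm_over \<Theta> (All x \<alpha>) \<longleftrightarrow> fm_over \<Theta> \<alpha>"
| "fm_over \<Theta> (Ex x \<alpha>) \<longleftrightarrow> fm_over \<Theta> \<alpha>"

definition For :: "('c, 'f, 'p) signature \<Rightarrow> ('c, 'f, 'p) fm set" where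
  "For \<Theta> = {\<phi>. fm_over \<Theta> \<phi>}"

primrec vars_tm :: "('c, 'f) tm \<Rightarrow> nat set" where
  "vars_tm (Var x) = {x}"
| "vars_tm (Const c) = {}"
| "vars_tm (Fun f ts) = \<Union> (set (map vars_tm ts))"

primrec fv :: "('c, 'f, 'p) fm \<Rightarrow> nat set" where
  "fv (Pred P ts) = \<Union> (set (map vars_tm ts))"
| "fv (And \<alpha> \<beta>) = fv \<alpha> \<union> fv \<beta>"
| "fv (Or \<alpha> \<beta>) = fv \<alpha> \<union> fv \<beta>"
| "fv (Imp \<alpha> \<beta>) = fv \<alpha> \<union> fv \<beta>"
| "fv (Neg \<alpha>) = fv \<alpha>"
| "fv (Circ \<alpha>) = fv \<alpha>"
| "fv (All x \<alpha>) = fv \<alpha> - {x}"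
| "fv (Ex x \<alpha>) = fv \<alpha> - {x}"

primrec subst_tm :: "nat \<Rightarrow> ('c, 'f) tm \<Rightarrow> ('c, 'f) tm \<Rightarrow> ('c, 'f) tm" where
  "subst_tm x t (Var y) = (if y = x then t else Var y)"
| "subst_tm x t (Const c) = Const c"
| "subst_tm x t (Fun f ts) = Fun f (map (subst_tm x t) ts)"

text \<open>\<open>subst x t \<phi>\<close> is \<open>\<phi>[x/t]\<close>: plain replacement of the free occurrences of
  \<open>x\<close>, without renaming of bound variables.\<close>

primrec subst :: "nat \<Rightarrow> ('c, 'f) tm \<Rightarrow> ('c, 'f, 'p) fm \<Rightarrow> ('c, 'f, 'p) fm" where
  "subst x t (Pred P ts) = Pred P (map (subst_tm x t) ts)"
| "subst x t (And \<alpha> \<beta>) = And (subst x t \<alpha>) (subst x t \<beta>)"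
| "subst x t (Or \<alpha> \<beta>) = Or (subst x t \<alpha>) (subst x t \<beta>)"
| "subst x t (Imp \<alpha> \<beta>) = Imp (subst x t \<alpha>) (subst x t \<beta>)"
| "subst x t (Neg \<alpha>) = Neg (subst x t \<alpha>)"
| "subst x t (Circ \<alpha>) = Circ (subst x t \<alpha>)"
| "subst x t (All y \<alpha>) = All y (if y = x then \<alpha> else subst x t \<alpha>)"
| "subst x t (Ex y \<alpha>) = Ex y (if y = x then \<alpha> else subst x t \<alpha>)"

text \<open>\<open>free_for t x \<phi>\<close>: no free occurrence of \<open>x\<close> in \<open>\<phi>\<close> lies in the scope
  of a quantifier binding a variable of \<open>t\<close>.\<close>

primrec free_for :: "('c, 'f) tm \<Rightarrow> nat \<Rightarrow> ('c, 'f, 'p) fm \<Rightarrow> bool" where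
  "free_for t x (Pred P ts) \<longleftrightarrow> True"
| "free_for t x (And \<alpha> \<beta>) \<longleftrightarrow> free_for t x \<alpha> \<and> free_for t x \<beta>"
| "free_for t x (Or \<alpha> \<beta>) \<longleftrightarrow> free_for t x \<alpha> \<and> free_for t x \<beta>"
| "free_for t x (Imp \<alpha> \<beta>) \<longleftrightarrow> free_for t x \<alpha> \<and> free_for t x \<beta>"
| "free_for t x (Neg \<alpha>) \<longleftrightarrow> free_for t x \<alpha>"
| "free_for t x (Circ \<alpha>) \<longleftrightarrow> free_for t x \<alpha>"
| "free_for t x (All y \<alpha>) \<longleftrightarrow> x \<notin> fv (All y \<alpha>) \<or> (y \<notin> vars_tm t \<and> free_for t x \<alpha>)"
| "free_for t x (Ex y \<alpha>) \<longleftrightarrow> x \<notin> fv (Ex y \<alpha>) \<or> (y \<notin> vars_tm t \<and> free_for t x \<alpha>)"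


section \<open>The calculus\<close>

inductive QLFI1_axiom :: "('c, 'f, 'p) fm \<Rightarrow> bool" where
  A1: "QLFI1_axiom (Imp \<alpha> (Imp \<beta> \<alpha>))"
| A2: "QLFI1_axiom (Imp (Imp \<alpha> (Imp \<beta> \<gamma>)) (Imp (Imp \<alpha> \<beta>) (Imp \<alpha> \<gamma>)))"
| A3: "QLFI1_axiom (Imp \<alpha> (Imp \<beta> (And \<alpha> \<beta>)))"
| A4: "QLFI1_axiom (Imp (And \<alpha> \<beta>) \<alpha>)"
| A5: "QLFI1_axiom (Imp (And \<alpha> \<beta>) \<beta>)"
| A6: "QLFI1_axiom (Imp \<alpha> (Or \<alpha> \<beta>))"
| A7: "QLFI1_axiom (Imp \<beta> (Or \<alpha> \<beta>))"
| A8: "QLFI1_axiom (Imp (Imp \<alpha> \<gamma>) (Imp (Imp \<beta> \<gamma>) (Imp (Or \<alpha> \<beta>) \<gamma>)))"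
| A9: "QLFI1_axiom (Or \<alpha> (Imp \<alpha> \<beta>))"
| A10: "QLFI1_axiom (Or \<alpha> (Neg \<alpha>))"
| A11: "QLFI1_axiom (Imp (Circ \<alpha>) (Imp \<alpha> (Imp (Neg \<alpha>) \<beta>)))"
| ci: "QLFI1_axiom (Imp (Neg (Circ \<alpha>)) (And \<alpha> (Neg \<alpha>)))"
| dneg: "QLFI1_axiom (Iff (Neg (Neg \<alpha>)) \<alpha>)"
| neg_or: "QLFI1_axiom (Iff (Neg (Or \<alpha> \<beta>)) (And (Neg \<alpha>) (Neg \<beta>)))"
| neg_and: "QLFI1_axiom (Iff (Neg (And \<alpha> \<beta>)) (Or (Neg \<alpha>) (Neg \<beta>)))"
| neg_imp: "QLFI1_axiom (Iff (Neg (Imp \<alpha> \<beta>)) (And \<alpha> (Neg \<beta>)))"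
| Ax12: "free_for t x \<phi> \<Longrightarrow> QLFI1_axiom (Imp (subst x t \<phi>) (Ex x \<phi>))"
| Ax13: "free_for t x \<phi> \<Longrightarrow> QLFI1_axiom (Imp (All x \<phi>) (subst x t \<phi>))"
| neg_Ex: "QLFI1_axiom (Iff (Neg (Ex x \<phi>)) (All x (Neg \<phi>)))"
| neg_All: "QLFI1_axiom (Iff (Neg (All x \<phi>)) (Ex x (Neg \<phi>)))"

text \<open>A derivation is a finite sequence of formulas over the signature.  The quantifier rules are
  not restricted by the variables free in \<open>\<Gamma>\<close>.\<close>

definition is_derivation ::
  "('c, 'f, 'p) signature \<Rightarrow> ('c, 'f, 'p) fm set \<Rightarrow> ('c, 'f, 'p) fm list \<Rightarrow> bool" where
  "is_derivation \<Theta> \<Gamma> ds \<longleftrightarrow> set ds \<subseteq> For \<Theta> \<and>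
     (\<forall>i < length ds.
        QLFI1_axiom (ds ! i)
      \<or> ds ! i \<in> \<Gamma>
      \<or> (\<exists>j < i. \<exists>k < i. ds ! k = Imp (ds ! j) (ds ! i))
      \<or> (\<exists>j < i. \<exists>x \<phi> \<psi>. ds ! j = Imp \<phi> \<psi> \<and> x \<notin> fv \<psi> \<and> ds ! i = Imp (Ex x \<phi>) \<psi>)
      \<or> (\<exists>j < i. \<exists>x \<phi> \<psi>. ds ! j = Imp \<phi> \<psi> \<and> x \<notin> fv \<phi> \<and> ds ! i = Imp \<phi> (All x \<psi>)))"

definition QLFI1_derivable ::
  "('c, 'f, 'p) signature \<Rightarrow> ('c, 'f, 'p) fm set \<Rightarrow> ('c, 'f, 'p) fm \<Rightarrow> bool" where
  "QLFI1_derivable \<Theta> \<Gamma> \<phi> \<longleftrightarrow> (\<exists>ds. is_derivation \<Theta> \<Gamma> ds \<and> ds \<noteq> [] \<and> last ds = \<phi>)"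


section \<open>The matrix\<close>

text \<open>\<open>Zero\<close>, \<open>Half\<close>, \<open>One\<close> stand for \<open>0\<close>, \<open>1/2\<close>, \<open>1\<close>.  Conjunction and
  disjunction are \<^const>\<open>min\<close> and \<^const>\<open>max\<close> for the order
  \<open>Zero < Half < One\<close>.\<close>

datatype tv = Zero | Half | One

instantiation tv :: linorder
begin

definition less_eq_tv :: "tv \<Rightarrow> tv \<Rightarrow> bool" where
  "x \<le> y \<longleftrightarrow> x = Zero \<or> y = One \<or> x = y"

definition less_tv :: "tv \<Rightarrow> tv \<Rightarrow> bool" where
  "x < y \<longleftrightarrow> x \<le> y \<and> x \<noteq> (y :: tv)"

instance
proof
  fix x y z :: tv
  show "(x < y) = (x \<le> y \<and> \<not> y \<le> x)"
    by (cases x; cases y) (auto simp: less_tv_def less_eq_tv_def)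
  show "x \<le> x"
    by (simp add: less_eq_tv_def)
  show "x \<le> z" if "x \<le> y" "y \<le> z"
    using that by (auto simp: less_eq_tv_def)
  show "x = y" if "x \<le> y" "y \<le> x"
    using that by (auto simp: less_eq_tv_def)
  show "x \<le> y \<or> y \<le> x"
    by (cases x; cases y) (auto simp: less_eq_tv_def)
qed

end

definition designated :: "tv set" where
  "designated = {One, Half}"

definition tv_imp :: "tv \<Rightarrow> tv \<Rightarrow> tv" where
  "tv_imp x y = (if x \<in> {One, Half} then y else One)"

fun tv_neg :: "tv \<Rightarrow> tv" where
  "tv_neg Zero = One"
| "tv_neg Half = Half"
| "tv_neg One = Zero"

fun tv_circ :: "tv \<Rightarrow> tv" where
  "tv_circ Zero = One"
| "tv_circ Half = Zero"
| "tv_circ One = One"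


section \<open>Structures and interpretation\<close>

text \<open>The domain is a subset of the type \<open>'u\<close>.  Interpretations of symbols outside the
  signature, or at arguments outside the domain, are irrelevant.

  Quantification over all structures has to fix \<open>'u\<close>, and a type with few elements cannot
  host enough counter-models for completeness.  The type of formulas always can: it is infinite and
  at least as large as each of \<open>'c\<close>, \<open>'f\<close>, \<open>'p\<close>, hence at least as large as
  the term model of a Henkin extension of the signature.\<close>

record ('c, 'f, 'p, 'u) struct =
  univ :: "'u set"
  cint :: "'c \<Rightarrow> 'u"
  fint :: "'f \<Rightarrow> 'u list \<Rightarrow> 'u"
  pint :: "'p \<Rightarrow> 'u list \<Rightarrow> tv"

definition is_struct :: "('c, 'f, 'p) signature \<Rightarrow> ('c, 'f, 'p, 'u) struct \<Rightarrow> bool" where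
  "is_struct \<Theta> \<AA> \<longleftrightarrow> univ \<AA> \<noteq> {}
     \<and> (\<forall>c \<in> const_syms \<Theta>. cint \<AA> c \<in> univ \<AA>)
     \<and> (\<forall>n \<ge> 1. \<forall>f \<in> fun_syms \<Theta> n. \<forall>us. length us = n \<longrightarrow> set us \<subseteq> univ \<AA> \<longrightarrow>
          fint \<AA> f us \<in> univ \<AA>)"

text \<open>The constants of the diagram signature are \<open>Inl c\<close> for the constants \<open>c\<close> of the
  given signature and \<open>Inr a\<close> for the name of \<open>a \<in> univ \<AA>\<close>.  Values are meaningful
  for closed terms and for sentences only.\<close>

primrec tm_val :: "('c, 'f, 'p, 'u) struct \<Rightarrow> ('c + 'u, 'f) tm \<Rightarrow> 'u" where
  "tm_val \<AA> (Var x) = undefined"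
| "tm_val \<AA> (Const d) = (case d of Inl c \<Rightarrow> cint \<AA> c | Inr a \<Rightarrow> a)"
| "tm_val \<AA> (Fun f ts) = fint \<AA> f (map (tm_val \<AA>) ts)"

primrec fm_rank :: "('c, 'f, 'p) fm \<Rightarrow> nat" where
  "fm_rank (Pred P ts) = 0"
| "fm_rank (And \<alpha> \<beta>) = Suc (fm_rank \<alpha> + fm_rank \<beta>)"
| "fm_rank (Or \<alpha> \<beta>) = Suc (fm_rank \<alpha> + fm_rank \<beta>)"
| "fm_rank (Imp \<alpha> \<beta>) = Suc (fm_rank \<alpha> + fm_rank \<beta>)"
| "fm_rank (Neg \<alpha>) = Suc (fm_rank \<alpha>)"
| "fm_rank (Circ \<alpha>) = Suc (fm_rank \<alpha>)"
| "fm_rank (All x \<alpha>) = Suc (fm_rank \<alpha>)"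
| "fm_rank (Ex x \<alpha>) = Suc (fm_rank \<alpha>)"

lemma fm_rank_subst [simp]: "fm_rank (subst x t \<phi>) = fm_rank \<phi>"
  by (induction \<phi>) auto

function (sequential) fm_val :: "('c, 'f, 'p, 'u) struct \<Rightarrow> ('c + 'u, 'f, 'p) fm \<Rightarrow> tv" where
  "fm_val \<AA> (Pred P ts) = pint \<AA> P (map (tm_val \<AA>) ts)"
| "fm_val \<AA> (And \<alpha> \<beta>) = min (fm_val \<AA> \<alpha>) (fm_val \<AA> \<beta>)"
| "fm_val \<AA> (Or \<alpha> \<beta>) = max (fm_val \<AA> \<alpha>) (fm_val \<AA> \<beta>)"
| "fm_val \<AA> (Imp \<alpha> \<beta>) = tv_imp (fm_val \<AA> \<alpha>) (fm_val \<AA> \<beta>)"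
| "fm_val \<AA> (Neg \<alpha>) = tv_neg (fm_val \<AA> \<alpha>)"
| "fm_val \<AA> (Circ \<alpha>) = tv_circ (fm_val \<AA> \<alpha>)"
| "fm_val \<AA> (All x \<phi>) = Min ((\<lambda>a. fm_val \<AA> (subst x (Const (Inr a)) \<phi>)) ` univ \<AA>)"
| "fm_val \<AA> (Ex x \<phi>) = Max ((\<lambda>a. fm_val \<AA> (subst x (Const (Inr a)) \<phi>)) ` univ \<AA>)"
  by pat_completeness auto
termination
  by (relation "measure (\<lambda>(\<AA>, \<phi>). fm_rank \<phi>)") auto

text \<open>\<open>close_fm \<mu> {} \<phi>\<close> replaces each free variable \<open>x\<close> of \<open>\<phi>\<close> by the name of
  \<open>\<mu> x\<close>.  The set argument collects the variables bound at the current position.\<close>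

primrec close_tm :: "(nat \<Rightarrow> 'u) \<Rightarrow> nat set \<Rightarrow> ('c, 'f) tm \<Rightarrow> ('c + 'u, 'f) tm" where
  "close_tm \<mu> B (Var x) = (if x \<in> B then Var x else Const (Inr (\<mu> x)))"
| "close_tm \<mu> B (Const c) = Const (Inl c)"
| "close_tm \<mu> B (Fun f ts) = Fun f (map (close_tm \<mu> B) ts)"

primrec close_fm :: "(nat \<Rightarrow> 'u) \<Rightarrow> nat set \<Rightarrow> ('c, 'f, 'p) fm \<Rightarrow> ('c + 'u, 'f, 'p) fm" where
  "close_fm \<mu> B (Pred P ts) = Pred P (map (close_tm \<mu> B) ts)"
| "close_fm \<mu> B (And \<alpha> \<beta>) = And (close_fm \<mu> B \<alpha>) (close_fm \<mu> B \<beta>)"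
| "close_fm \<mu> B (Or \<alpha> \<beta>) = Or (close_fm \<mu> B \<alpha>) (close_fm \<mu> B \<beta>)"
| "close_fm \<mu> B (Imp \<alpha> \<beta>) = Imp (close_fm \<mu> B \<alpha>) (close_fm \<mu> B \<beta>)"
| "close_fm \<mu> B (Neg \<alpha>) = Neg (close_fm \<mu> B \<alpha>)"
| "close_fm \<mu> B (Circ \<alpha>) = Circ (close_fm \<mu> B \<alpha>)"
| "close_fm \<mu> B (All x \<alpha>) = All x (close_fm \<mu> (insert x B) \<alpha>)"
| "close_fm \<mu> B (Ex x \<alpha>) = Ex x (close_fm \<mu> (insert x B) \<alpha>)"

definition fm_val_asg ::
  "('c, 'f, 'p, 'u) struct \<Rightarrow> (nat \<Rightarrow> 'u) \<Rightarrow> ('c, 'f, 'p) fm \<Rightarrow> tv" where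
  "fm_val_asg \<AA> \<mu> \<phi> = fm_val \<AA> (close_fm \<mu> {} \<phi>)"

definition assignments :: "('c, 'f, 'p, 'u) struct \<Rightarrow> (nat \<Rightarrow> 'u) set" where
  "assignments \<AA> = {\<mu>. range \<mu> \<subseteq> univ \<AA>}"

definition consequence ::
  "('c, 'f, 'p, 'u) struct \<Rightarrow> ('c, 'f, 'p) fm set \<Rightarrow> ('c, 'f, 'p) fm \<Rightarrow> bool" where
  "consequence \<AA> \<Gamma> \<phi> \<longleftrightarrow>
     (\<forall>\<gamma> \<in> \<Gamma>. \<forall>\<mu> \<in> assignments \<AA>. fm_val_asg \<AA> \<mu> \<gamma> \<in> designated) \<longrightarrow>
     (\<forall>\<mu> \<in> assignments \<AA>. fm_val_asg \<AA> \<mu> \<phi> \<in> designated)"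

end

theory Submission
  imports Defs
begin

text \<open>Completeness is a Henkin argument.  In the language enriched with a witness for every
  existential formula, a theory maximal among those not proving a fixed sentence \<open>\<psi>\<close> decides
  every sentence: by (A9), an unprovable \<open>\<alpha>\<close> satisfies \<open>\<alpha> \<rightarrow> \<psi>\<close>, which plays the role of classical
  negation.  A sentence gets the value \<open>0\<close> if it is unprovable, \<open>1/2\<close> if it is provable together
  with its paraconsistent negation, and \<open>1\<close> otherwise; the axioms for \<open>\<not>\<close> and \<open>\<circ>\<close> say that this
  valuation obeys the matrix, and universal quantifiers are handled by the theorem
  \<open>\<exists>x(\<phi> \<rightarrow> \<forall>x\<phi>)\<close>.\<close>

section \<open>Semantics by assignments\<close>

text \<open>Both sides of the equivalence are global: the quantifier rules ignore the variables free
  in \<Gamma>, and consequence compares validity under all assignments. So the deduction theorem is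
  available for sentences only, and open formulas are traded for their universal closures. Three
  further obstacles shape the proof. The Henkin language has symbols outside \<Theta>, so
  derivations are studied over the raw syntax and pulled back by turning foreign terms into a fresh
  variable. The signature may have any cardinality, so the maximal theory comes from Zorn's lemma
  and not from an enumeration of sentences. The counter-model must live on the type of formulas over
  the original symbols, so the closed Henkin terms are encoded injectively into that type.\<close>

primrec eval_tm :: "('c, 'f, 'p, 'u) struct \<Rightarrow> (nat \<Rightarrow> 'u) \<Rightarrow> ('c, 'f) tm \<Rightarrow> 'u" where
  "eval_tm \<AA> \<mu> (Var x) = \<mu> x"
| "eval_tm \<AA> \<mu> (Const c) = cint \<AA> c"
| "eval_tm \<AA> \<mu> (Fun f ts) = fint \<AA> f (map (eval_tm \<AA> \<mu>) ts)"

text \<open>The official value of a quantified formula substitutes names, and the result is not a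
  subformula. Updating the assignment instead turns the semantic arguments into structural
  inductions.\<close>

primrec eval_fm :: "('c, 'f, 'p, 'u) struct \<Rightarrow> (nat \<Rightarrow> 'u) \<Rightarrow> ('c, 'f, 'p) fm \<Rightarrow> tv" where
  "eval_fm \<AA> \<mu> (Pred P ts) = pint \<AA> P (map (eval_tm \<AA> \<mu>) ts)"
| "eval_fm \<AA> \<mu> (And \<alpha> \<beta>) = min (eval_fm \<AA> \<mu> \<alpha>) (eval_fm \<AA> \<mu> \<beta>)"
| "eval_fm \<AA> \<mu> (Or \<alpha> \<beta>) = max (eval_fm \<AA> \<mu> \<alpha>) (eval_fm \<AA> \<mu> \<beta>)"
| "eval_fm \<AA> \<mu> (Imp \<alpha> \<beta>) = tv_imp (eval_fm \<AA> \<mu> \<alpha>) (eval_fm \<AA> \<mu> \<beta>)"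
| "eval_fm \<AA> \<mu> (Neg \<alpha>) = tv_neg (eval_fm \<AA> \<mu> \<alpha>)"
| "eval_fm \<AA> \<mu> (Circ \<alpha>) = tv_circ (eval_fm \<AA> \<mu> \<alpha>)"
| "eval_fm \<AA> \<mu> (All x \<phi>) = Min ((\<lambda>a. eval_fm \<AA> (\<mu>(x := a)) \<phi>) ` univ \<AA>)"
| "eval_fm \<AA> \<mu> (Ex x \<phi>) = Max ((\<lambda>a. eval_fm \<AA> (\<mu>(x := a)) \<phi>) ` univ \<AA>)"

lemma close_tm_cong:
  "(\<And>x. x \<notin> B \<Longrightarrow> \<mu> x = \<nu> x) \<Longrightarrow> close_tm \<mu> B t = close_tm \<nu> B t"
  by (induction t) auto

lemma close_fm_cong:
  "(\<And>x. x \<notin> B \<Longrightarrow> \<mu> x = \<nu> x) \<Longrightarrow> close_fm \<mu> B \<phi> = close_fm \<nu> B \<phi>"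
proof (induction \<phi> arbitrary: B)
  case (Pred P ts)
  then show ?case by (auto intro: close_tm_cong)
next
  case (All x \<phi>)
  show ?case using All.IH[of "insert x B"] All.prems by auto
next
  case (Ex x \<phi>)
  show ?case using Ex.IH[of "insert x B"] Ex.prems by auto
next
  case (And \<alpha> \<beta>)
  then show ?case by (metis close_fm.simps(2))
next
  case (Or \<alpha> \<beta>)
  then show ?case by (metis close_fm.simps(3))
next
  case (Imp \<alpha> \<beta>)
  then show ?case by (metis close_fm.simps(4))
next
  case (Neg \<alpha>)
  then show ?case by (metis close_fm.simps(5))
next
  case (Circ \<alpha>)
  then show ?case by (metis close_fm.simps(6))
qed

lemma subst_close_tm:
  "subst_tm x (Const (Inr a)) (close_tm \<mu> (insert x B) t) = close_tm (\<mu>(x := a)) (B - {x}) t"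
  by (induction t) auto

text \<open>Under its quantifier \<open>x\<close> stays open, and putting a name there amounts to
  closing with the updated assignment. On the right \<open>x\<close> leaves \<open>B\<close> so that
  the update takes effect.\<close>

lemma subst_close_fm:
  "subst x (Const (Inr a)) (close_fm \<mu> (insert x B) \<phi>) = close_fm (\<mu>(x := a)) (B - {x}) \<phi>"
proof (induction \<phi> arbitrary: B)
  case (Pred P ts)
  then show ?case by (simp add: subst_close_tm fun_upd_def)
next
  case (All y \<phi>)
  show ?case
  proof (cases "y = x")
    case True
    then show ?thesis by (simp, intro close_fm_cong) auto
  next
    case False
    then show ?thesis
      using All.IH[of "insert y B"] by (simp add: insert_commute insert_Diff_if)
  qed
next
  case (Ex y \<phi>)
  show ?case
  proof (cases "y = x")
    case True
    then show ?thesis by (simp, intro close_fm_cong) auto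
  next
    case False
    then show ?thesis
      using Ex.IH[of "insert y B"] by (simp add: insert_commute insert_Diff_if)
  qed
qed auto

lemma tm_val_close_tm: "tm_val \<AA> (close_tm \<mu> {} t) = eval_tm \<AA> \<mu> t"
  by (induction t) (auto simp: comp_def intro!: arg_cong[where f = "fint \<AA> _"])

lemma fm_val_asg_eq: "fm_val_asg \<AA> \<mu> \<phi> = eval_fm \<AA> \<mu> \<phi>"
  unfolding fm_val_asg_def
proof (induction \<phi> arbitrary: \<mu>)
  case (Pred P ts)
  then show ?case by (simp add: comp_def tm_val_close_tm)
next
  case (All x \<phi>)
  then show ?case by (simp add: subst_close_fm fun_upd_def)
next
  case (Ex x \<phi>)
  then show ?case by (simp add: subst_close_fm fun_upd_def)
qed auto

section \<open>Truth values\<close>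

lemma designated_iff: "v \<in> designated \<longleftrightarrow> v \<noteq> Zero"
  by (cases v) (auto simp: designated_def)

text \<open>Two bits determine a truth value. In the term model they are the unprovability of a
  sentence and of its negation, so each matrix clause splits into two statements about
  provability.\<close>

lemma tv_eqI: "(v = Zero \<longleftrightarrow> w = Zero) \<Longrightarrow> (v = One \<longleftrightarrow> w = One) \<Longrightarrow> v = w"
  by (cases v; cases w) auto

text \<open>Even over an infinite domain the quantifiers take the minimum or maximum of a finite set
  of values, as \<open>Min\<close> and \<open>Max\<close> require.\<close>

lemma finite_tv_set [simp]: "finite (X :: tv set)"
proof -
  have "v \<in> {Zero, Half, One}" for v
    by (cases v) auto
  then show ?thesis
    by (meson finite.emptyI finite.insertI finite_subset subsetI)
qed

lemma Zero_le [simp]: "Zero \<le> v"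
  by (simp add: less_eq_tv_def)

lemma le_One [simp]: "v \<le> One"
  by (simp add: less_eq_tv_def)

lemma le_Zero_iff [simp]: "v \<le> Zero \<longleftrightarrow> v = Zero"
  by (auto simp: less_eq_tv_def)

lemma One_le_iff [simp]: "One \<le> v \<longleftrightarrow> v = One"
  by (auto simp: less_eq_tv_def)

lemma min_tv_iff:
  "min v w = Zero \<longleftrightarrow> v = Zero \<or> w = Zero" "min v w = One \<longleftrightarrow> v = One \<and> w = One"
  by (cases v; cases w; simp add: min_def less_eq_tv_def)+

lemma max_tv_iff:
  "max v w = Zero \<longleftrightarrow> v = Zero \<and> w = Zero" "max v w = One \<longleftrightarrow> v = One \<or> w = One"
  by (cases v; cases w; simp add: max_def less_eq_tv_def)+

lemma tv_imp_iff:
  "tv_imp v w = Zero \<longleftrightarrow> v \<noteq> Zero \<and> w = Zero" "tv_imp v w = One \<longleftrightarrow> v = Zero \<or> w = One"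
  by (cases v; cases w; simp add: tv_imp_def)+

lemma tv_neg_iff: "tv_neg v = Zero \<longleftrightarrow> v = One" "tv_neg v = One \<longleftrightarrow> v = Zero"
  by (cases v; simp)+

lemma tv_circ_iff:
  "tv_circ v = Zero \<longleftrightarrow> v \<noteq> Zero \<and> v \<noteq> One" "tv_circ v = One \<longleftrightarrow> v = Zero \<or> v = One"
  by (cases v; simp)+

lemma Min_tv_iff:
  assumes "X \<noteq> {}"
  shows "Min X = Zero \<longleftrightarrow> Zero \<in> X" "Min X = One \<longleftrightarrow> (\<forall>v\<in>X. v = One)"
proof -
  show "Min X = Zero \<longleftrightarrow> Zero \<in> X"
    using Min_eq_iff[OF finite_tv_set assms, of Zero] by simp
  show "Min X = One \<longleftrightarrow> (\<forall>v\<in>X. v = One)"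
    using Min_ge_iff[OF finite_tv_set assms, of One] by simp
qed

lemma Max_tv_iff:
  assumes "X \<noteq> {}"
  shows "Max X = Zero \<longleftrightarrow> (\<forall>v\<in>X. v = Zero)" "Max X = One \<longleftrightarrow> One \<in> X"
proof -
  show "Max X = Zero \<longleftrightarrow> (\<forall>v\<in>X. v = Zero)"
    using Max_le_iff[OF finite_tv_set assms, of Zero] by simp
  show "Max X = One \<longleftrightarrow> One \<in> X"
    using Max_eq_iff[OF finite_tv_set assms, of One] by simp
qed

lemmas tv_iffs = min_tv_iff max_tv_iff tv_imp_iff tv_neg_iff tv_circ_iff

section \<open>Coincidence and substitution\<close>

lemma eval_tm_cong:
  "(\<And>x. x \<in> vars_tm t \<Longrightarrow> \<mu> x = \<nu> x) \<Longrightarrow> eval_tm \<AA> \<mu> t = eval_tm \<AA> \<nu> t"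
proof (induction t)
  case (Fun f ts)
  have "map (eval_tm \<AA> \<mu>) ts = map (eval_tm \<AA> \<nu>) ts"
    using Fun by (intro map_cong refl Fun.IH) auto
  then show ?case by (simp only: eval_tm.simps)
qed auto

lemma eval_fm_cong:
  "(\<And>x. x \<in> fv \<phi> \<Longrightarrow> \<mu> x = \<nu> x) \<Longrightarrow> eval_fm \<AA> \<mu> \<phi> = eval_fm \<AA> \<nu> \<phi>"
proof (induction \<phi> arbitrary: \<mu> \<nu>)
  case (Pred P ts)
  have "map (eval_tm \<AA> \<mu>) ts = map (eval_tm \<AA> \<nu>) ts"
    using Pred by (intro map_cong refl eval_tm_cong) auto
  then show ?case by (simp only: eval_fm.simps)
next
  case (And \<alpha> \<beta>)
  have "eval_fm \<AA> \<mu> \<alpha> = eval_fm \<AA> \<nu> \<alpha>" "eval_fm \<AA> \<mu> \<beta> = eval_fm \<AA> \<nu> \<beta>"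
    by (rule And.IH, simp add: And.prems)+
  then show ?case by simp
next
  case (Or \<alpha> \<beta>)
  have "eval_fm \<AA> \<mu> \<alpha> = eval_fm \<AA> \<nu> \<alpha>" "eval_fm \<AA> \<mu> \<beta> = eval_fm \<AA> \<nu> \<beta>"
    by (rule Or.IH, simp add: Or.prems)+
  then show ?case by simp
next
  case (Imp \<alpha> \<beta>)
  have "eval_fm \<AA> \<mu> \<alpha> = eval_fm \<AA> \<nu> \<alpha>" "eval_fm \<AA> \<mu> \<beta> = eval_fm \<AA> \<nu> \<beta>"
    by (rule Imp.IH, simp add: Imp.prems)+
  then show ?case by simp
next
  case (Neg \<alpha>)
  have "eval_fm \<AA> \<mu> \<alpha> = eval_fm \<AA> \<nu> \<alpha>"
    by (rule Neg.IH, simp add: Neg.prems)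
  then show ?case by simp
next
  case (Circ \<alpha>)
  have "eval_fm \<AA> \<mu> \<alpha> = eval_fm \<AA> \<nu> \<alpha>"
    by (rule Circ.IH, simp add: Circ.prems)
  then show ?case by simp
next
  case (All x \<phi>)
  have "eval_fm \<AA> (\<mu>(x := a)) \<phi> = eval_fm \<AA> (\<nu>(x := a)) \<phi>" for a
    using All.prems by (intro All.IH) auto
  then show ?case by simp
next
  case (Ex x \<phi>)
  have "eval_fm \<AA> (\<mu>(x := a)) \<phi> = eval_fm \<AA> (\<nu>(x := a)) \<phi>" for a
    using Ex.prems by (intro Ex.IH) auto
  then show ?case by simp
qed

lemma eval_subst_tm:
  "eval_tm \<AA> \<mu> (subst_tm x t s) = eval_tm \<AA> (\<mu>(x := eval_tm \<AA> \<mu> t)) s"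
  by (induction s) (auto simp: comp_def intro!: arg_cong[where f = "fint \<AA> _"])

lemma subst_tm_not_free [simp]: "x \<notin> vars_tm s \<Longrightarrow> subst_tm x t s = s"
  by (induction s) (auto simp: map_idI)

lemma subst_not_free [simp]: "x \<notin> fv \<phi> \<Longrightarrow> subst x t \<phi> = \<phi>"
  by (induction \<phi>) (auto simp: map_idI)

lemma subst_tm_Var [simp]: "subst_tm x (Var x) t = t"
  by (induction t) (auto simp: map_idI)

lemma subst_Var [simp]: "subst x (Var x) \<phi> = \<phi>"
  by (induction \<phi>) (auto simp: map_idI)

text \<open>A quantifier over \<open>x\<close> hides the occurrences of \<open>x\<close> below it,
  so nothing is captured. With \<open>subst_Var\<close> this makes \<phi> \<rightarrow>
  \<exists>x\<phi> and \<forall>x\<phi> \<rightarrow> \<phi> instances of Ax12 and Ax13.\<close>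

lemma free_for_Var [simp]: "free_for (Var x) x \<phi>"
  by (induction \<phi>) auto

lemma free_for_closed [simp]: "vars_tm t = {} \<Longrightarrow> free_for t x \<phi>"
  by (induction \<phi>) auto

text \<open>If \<open>x\<close> is not free in a quantified formula, \<open>free_for\<close> says
  nothing about \<open>t\<close>, but the substitution changes nothing and coincidence applies.
  Otherwise the bound \<open>y\<close> does not occur in \<open>t\<close>, so updating
  \<open>y\<close> leaves the value of \<open>t\<close> alone and the two updates commute.\<close>

lemma eval_subst:
  "free_for t x \<phi> \<Longrightarrow> eval_fm \<AA> \<mu> (subst x t \<phi>) = eval_fm \<AA> (\<mu>(x := eval_tm \<AA> \<mu> t)) \<phi>"
proof (induction \<phi> arbitrary: \<mu>)
  case (Pred P ts)
  have "map (eval_tm \<AA> \<mu>) (map (subst_tm x t) ts) = map (eval_tm \<AA> (\<mu>(x := eval_tm \<AA> \<mu> t))) ts"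
    by (simp only: map_map comp_def eval_subst_tm)
  then show ?case by (simp only: subst.simps eval_fm.simps)
next
  case (All y \<phi>)
  show ?case
  proof (cases "x \<in> fv (All y \<phi>)")
    case False
    then have "eval_fm \<AA> (\<mu>(x := eval_tm \<AA> \<mu> t)) (All y \<phi>) = eval_fm \<AA> \<mu> (All y \<phi>)"
      by (intro eval_fm_cong) auto
    then show ?thesis
      using subst_not_free[OF False] by metis
  next
    case True
    then have "y \<noteq> x" "y \<notin> vars_tm t" "free_for t x \<phi>"
      using All.prems by auto
    moreover from this have "eval_tm \<AA> (\<mu>(y := a)) t = eval_tm \<AA> \<mu> t" for a
      by (intro eval_tm_cong) auto
    ultimately show ?thesis
      using All.IH by (simp only: subst.simps eval_fm.simps if_False fun_upd_twist)
  qed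
next
  case (Ex y \<phi>)
  show ?case
  proof (cases "x \<in> fv (Ex y \<phi>)")
    case False
    then have "eval_fm \<AA> (\<mu>(x := eval_tm \<AA> \<mu> t)) (Ex y \<phi>) = eval_fm \<AA> \<mu> (Ex y \<phi>)"
      by (intro eval_fm_cong) auto
    then show ?thesis
      using subst_not_free[OF False] by metis
  next
    case True
    then have "y \<noteq> x" "y \<notin> vars_tm t" "free_for t x \<phi>"
      using Ex.prems by auto
    moreover from this have "eval_tm \<AA> (\<mu>(y := a)) t = eval_tm \<AA> \<mu> t" for a
      by (intro eval_tm_cong) auto
    ultimately show ?thesis
      using Ex.IH by (simp only: subst.simps eval_fm.simps if_False fun_upd_twist)
  qed
qed auto

lemma eval_tm_in_univ:
  assumes "is_struct \<Theta> \<AA>" "\<mu> \<in> assignments \<AA>" "tm_over \<Theta> t"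
  shows "eval_tm \<AA> \<mu> t \<in> univ \<AA>"
  using assms(3)
proof (induction t)
  case (Var x)
  then show ?case using assms(2) by (auto simp: assignments_def)
next
  case (Const c)
  then show ?case using assms(1) by (auto simp: is_struct_def)
next
  case (Fun f ts)
  then have "set (map (eval_tm \<AA> \<mu>) ts) \<subseteq> univ \<AA>"
    by (auto simp: list_all_iff)
  moreover have "f \<in> fun_syms \<Theta> (length ts)" "length ts \<ge> 1"
    using Fun.prems by (cases ts; simp)+
  ultimately show ?case
    using assms(1) by (simp add: is_struct_def)
qed


section \<open>Derivability\<close>

text \<open>The set \<open>F\<close> restricts the formulas that may occur in a derivation.  For
  \<open>F = UNIV\<close> all well-formedness conditions disappear.  This is harmless because symbols
  outside the signature can be eliminated from derivations afterwards.\<close>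

inductive prv :: "('c, 'f, 'p) fm set \<Rightarrow> ('c, 'f, 'p) fm set \<Rightarrow> ('c, 'f, 'p) fm \<Rightarrow> bool"
  for F \<Gamma> where
  ax: "QLFI1_axiom \<phi> \<Longrightarrow> \<phi> \<in> F \<Longrightarrow> prv F \<Gamma> \<phi>"
| hyp: "\<phi> \<in> \<Gamma> \<Longrightarrow> \<phi> \<in> F \<Longrightarrow> prv F \<Gamma> \<phi>"
| mp: "prv F \<Gamma> (Imp \<phi> \<psi>) \<Longrightarrow> prv F \<Gamma> \<phi> \<Longrightarrow> \<psi> \<in> F \<Longrightarrow> prv F \<Gamma> \<psi>"
| ex_intro: "prv F \<Gamma> (Imp \<phi> \<psi>) \<Longrightarrow> x \<notin> fv \<psi> \<Longrightarrow> Imp (Ex x \<phi>) \<psi> \<in> F \<Longrightarrow> prv F \<Gamma> (Imp (Ex x \<phi>) \<psi>)"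
| all_intro: "prv F \<Gamma> (Imp \<phi> \<psi>) \<Longrightarrow> x \<notin> fv \<phi> \<Longrightarrow> Imp \<phi> (All x \<psi>) \<in> F \<Longrightarrow> prv F \<Gamma> (Imp \<phi> (All x \<psi>))"

section \<open>Derivation sequences and the inductive predicate\<close>

abbreviation step_ok where
  "step_ok \<Gamma> ds i \<equiv> QLFI1_axiom (ds ! i)
      \<or> ds ! i \<in> \<Gamma>
      \<or> (\<exists>j < i. \<exists>k < i. ds ! k = Imp (ds ! j) (ds ! i))
      \<or> (\<exists>j < i. \<exists>x \<phi> \<psi>. ds ! j = Imp \<phi> \<psi> \<and> x \<notin> fv \<psi> \<and> ds ! i = Imp (Ex x \<phi>) \<psi>)
      \<or> (\<exists>j < i. \<exists>x \<phi> \<psi>. ds ! j = Imp \<phi> \<psi> \<and> x \<notin> fv \<phi> \<and> ds ! i = Imp \<phi> (All x \<psi>))"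

lemma is_derivation_imp_prv:
  assumes "is_derivation \<Theta> \<Gamma> ds" "i < length ds"
  shows "prv (For \<Theta>) \<Gamma> (ds ! i)"
  using assms(2)
proof (induction i rule: less_induct)
  case (less i)
  have F: "ds ! i \<in> For \<Theta>"
    using assms(1) less.prems unfolding is_derivation_def by auto
  have IH: "prv (For \<Theta>) \<Gamma> (ds ! j)" if "j < i" for j
    using less that by auto
  have "step_ok \<Gamma> ds i"
    using assms(1) less.prems unfolding is_derivation_def by simp
  then consider "QLFI1_axiom (ds ! i)" | "ds ! i \<in> \<Gamma>"
    | j k where "j < i" "k < i" "ds ! k = Imp (ds ! j) (ds ! i)"
    | j x \<phi> \<psi> where "j < i" "ds ! j = Imp \<phi> \<psi>" "x \<notin> fv \<psi>" "ds ! i = Imp (Ex x \<phi>) \<psi>"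
    | j x \<phi> \<psi> where "j < i" "ds ! j = Imp \<phi> \<psi>" "x \<notin> fv \<phi>" "ds ! i = Imp \<phi> (All x \<psi>)"
    by blast
  then show ?case
  proof cases
    case 1
    then show ?thesis using F prv.ax by blast
  next
    case 2
    then show ?thesis using F prv.hyp by blast
  next
    case 3
    then show ?thesis using F IH[of j] IH[of k] by (auto intro: prv.mp)
  next
    case 4
    then show ?thesis using F IH[of j] by (auto intro: prv.ex_intro)
  next
    case 5
    then show ?thesis using F IH[of j] by (auto intro: prv.all_intro)
  qed
qed

lemma step_ok_append1:
  assumes "i < length ds" "step_ok \<Gamma> ds i"
  shows "step_ok \<Gamma> (ds @ es) i"
proof -
  have "(ds @ es) ! j = ds ! j" if "j \<le> i" for j
    using assms(1) that by (simp add: nth_append)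
  then show ?thesis
    using assms(2) by (elim disjE exE conjE) (metis less_imp_le order_refl)+
qed

lemma is_derivation_append:
  assumes "is_derivation \<Theta> \<Gamma> ds" "is_derivation \<Theta> \<Gamma> es"
  shows "is_derivation \<Theta> \<Gamma> (ds @ es)"
  unfolding is_derivation_def
proof (intro conjI allI impI)
  show "set (ds @ es) \<subseteq> For \<Theta>"
    using assms by (auto simp: is_derivation_def)
next
  fix i
  assume i: "i < length (ds @ es)"
  show "step_ok \<Gamma> (ds @ es) i"
  proof (cases "i < length ds")
    case True
    then show ?thesis
      using assms(1) by (intro step_ok_append1) (auto simp: is_derivation_def)
  next
    case False
    define n where "n = length ds"
    define m where "m = i - n"
    have "m < length es" and i_eq: "i = n + m"
      using i False by (auto simp: n_def m_def)
    then have st: "step_ok \<Gamma> es m"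
      using assms(2) unfolding is_derivation_def by simp
    have nth: "es ! j = (ds @ es) ! (n + j)" for j
      by (simp add: n_def nth_append)
    show ?thesis
      using st unfolding i_eq nth by (metis nat_add_left_cancel_less)
  qed
qed

lemma derivable_snoc:
  assumes "is_derivation \<Theta> \<Gamma> ds" "\<phi> \<in> For \<Theta>" "step_ok \<Gamma> (ds @ [\<phi>]) (length ds)"
  shows "QLFI1_derivable \<Theta> \<Gamma> \<phi>"
proof -
  have "is_derivation \<Theta> \<Gamma> (ds @ [\<phi>])"
    unfolding is_derivation_def
  proof (intro conjI allI impI)
    show "set (ds @ [\<phi>]) \<subseteq> For \<Theta>"
      using assms by (auto simp: is_derivation_def)
  next
    fix i
    assume "i < length (ds @ [\<phi>])"
    then consider "i < length ds" | "i = length ds"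
      by fastforce
    then show "step_ok \<Gamma> (ds @ [\<phi>]) i"
    proof cases
      case 1
      then show ?thesis
        using assms(1) by (intro step_ok_append1) (auto simp: is_derivation_def)
    next
      case 2
      then show ?thesis using assms(3) by simp
    qed
  qed
  then show ?thesis
    unfolding QLFI1_derivable_def by (intro exI[of _ "ds @ [\<phi>]"]) simp
qed

lemma last_nth_append: "es \<noteq> [] \<Longrightarrow> (ds @ es @ rs) ! (length ds + (length es - 1)) = last es"
  by (simp add: nth_append last_conv_nth)

lemma derivable_mp:
  assumes "QLFI1_derivable \<Theta> \<Gamma> (Imp \<phi> \<psi>)" "QLFI1_derivable \<Theta> \<Gamma> \<phi>" "\<psi> \<in> For \<Theta>"
  shows "QLFI1_derivable \<Theta> \<Gamma> \<psi>"
proof -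
  obtain ds es where ds: "is_derivation \<Theta> \<Gamma> ds" "ds \<noteq> []" "last ds = Imp \<phi> \<psi>"
    and es: "is_derivation \<Theta> \<Gamma> es" "es \<noteq> []" "last es = \<phi>"
    using assms unfolding QLFI1_derivable_def by blast
  let ?l = "(ds @ es) @ [\<psi>]" and ?n = "length (ds @ es)"
  have "length ds > 0" "length es > 0"
    using ds es by auto
  then have lt: "length ds - 1 < ?n" "length ds + (length es - 1) < ?n"
    unfolding length_append by linarith+
  have "?l ! (length ds - 1) = Imp (?l ! (length ds + (length es - 1))) (?l ! ?n)"
    using last_nth_append[of ds "[]" "es @ [\<psi>]"] last_nth_append[of es ds "[\<psi>]"] ds es by simp
  then have "step_ok \<Gamma> ?l ?n"
    using lt by blast
  then show ?thesis
    by (rule derivable_snoc[OF is_derivation_append[OF ds(1) es(1)] assms(3)])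
qed

lemma derivable_exI:
  assumes "QLFI1_derivable \<Theta> \<Gamma> (Imp \<phi> \<psi>)" "x \<notin> fv \<psi>" "Imp (Ex x \<phi>) \<psi> \<in> For \<Theta>"
  shows "QLFI1_derivable \<Theta> \<Gamma> (Imp (Ex x \<phi>) \<psi>)"
proof -
  obtain ds where ds: "is_derivation \<Theta> \<Gamma> ds" "ds \<noteq> []" "last ds = Imp \<phi> \<psi>"
    using assms unfolding QLFI1_derivable_def by blast
  let ?l = "ds @ [Imp (Ex x \<phi>) \<psi>]"
  have "?l ! (length ds - 1) = Imp \<phi> \<psi>" "length ds - 1 < length ds"
    using last_nth_append[of ds "[]" "[Imp (Ex x \<phi>) \<psi>]"] ds by simp_all
  moreover have "?l ! length ds = Imp (Ex x \<phi>) \<psi>"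
    by simp
  ultimately have "step_ok \<Gamma> ?l (length ds)"
    using assms(2) by blast
  then show ?thesis
    by (rule derivable_snoc[OF ds(1) assms(3)])
qed

lemma derivable_allI:
  assumes "QLFI1_derivable \<Theta> \<Gamma> (Imp \<phi> \<psi>)" "x \<notin> fv \<phi>" "Imp \<phi> (All x \<psi>) \<in> For \<Theta>"
  shows "QLFI1_derivable \<Theta> \<Gamma> (Imp \<phi> (All x \<psi>))"
proof -
  obtain ds where ds: "is_derivation \<Theta> \<Gamma> ds" "ds \<noteq> []" "last ds = Imp \<phi> \<psi>"
    using assms unfolding QLFI1_derivable_def by blast
  let ?l = "ds @ [Imp \<phi> (All x \<psi>)]"
  have "?l ! (length ds - 1) = Imp \<phi> \<psi>" "length ds - 1 < length ds"
    using last_nth_append[of ds "[]" "[Imp \<phi> (All x \<psi>)]"] ds by simp_all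
  moreover have "?l ! length ds = Imp \<phi> (All x \<psi>)"
    by simp
  ultimately have "step_ok \<Gamma> ?l (length ds)"
    using assms(2) by blast
  then show ?thesis
    by (rule derivable_snoc[OF ds(1) assms(3)])
qed

lemma derivable_iff_prv: "QLFI1_derivable \<Theta> \<Gamma> \<phi> \<longleftrightarrow> prv (For \<Theta>) \<Gamma> \<phi>"
proof
  assume "QLFI1_derivable \<Theta> \<Gamma> \<phi>"
  then obtain ds where ds: "is_derivation \<Theta> \<Gamma> ds" "ds \<noteq> []" "last ds = \<phi>"
    unfolding QLFI1_derivable_def by blast
  then show "prv (For \<Theta>) \<Gamma> \<phi>"
    using is_derivation_imp_prv[OF ds(1), of "length ds - 1"] by (simp add: last_conv_nth)
next
  assume "prv (For \<Theta>) \<Gamma> \<phi>"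
  then show "QLFI1_derivable \<Theta> \<Gamma> \<phi>"
  proof (induction rule: prv.induct)
    case (ax \<phi>)
    then show ?case by (intro derivable_snoc[of _ _ "[]"]) (auto simp: is_derivation_def)
  next
    case (hyp \<phi>)
    then show ?case by (intro derivable_snoc[of _ _ "[]"]) (auto simp: is_derivation_def)
  qed (auto intro: derivable_mp derivable_exI derivable_allI)
qed


section \<open>Soundness\<close>

definition valid_in :: "('c, 'f, 'p, 'u) struct \<Rightarrow> ('c, 'f, 'p) fm \<Rightarrow> bool" where
  "valid_in \<AA> \<phi> \<longleftrightarrow> (\<forall>\<mu> \<in> assignments \<AA>. eval_fm \<AA> \<mu> \<phi> \<noteq> Zero)"

lemma consequence_iff: "consequence \<AA> \<Gamma> \<phi> \<longleftrightarrow> ((\<forall>\<gamma>\<in>\<Gamma>. valid_in \<AA> \<gamma>) \<longrightarrow> valid_in \<AA> \<phi>)"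
  by (simp add: consequence_def valid_in_def fm_val_asg_eq designated_iff)

lemma upd_assignments: "\<mu> \<in> assignments \<AA> \<Longrightarrow> a \<in> univ \<AA> \<Longrightarrow> \<mu>(x := a) \<in> assignments \<AA>"
  by (auto simp: assignments_def)

lemma eval_quant_iff:
  assumes "univ \<AA> \<noteq> {}"
  shows "eval_fm \<AA> \<mu> (All x \<phi>) = Zero \<longleftrightarrow> (\<exists>a\<in>univ \<AA>. eval_fm \<AA> (\<mu>(x := a)) \<phi> = Zero)"
    "eval_fm \<AA> \<mu> (All x \<phi>) = One \<longleftrightarrow> (\<forall>a\<in>univ \<AA>. eval_fm \<AA> (\<mu>(x := a)) \<phi> = One)"
    "eval_fm \<AA> \<mu> (Ex x \<phi>) = Zero \<longleftrightarrow> (\<forall>a\<in>univ \<AA>. eval_fm \<AA> (\<mu>(x := a)) \<phi> = Zero)"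
    "eval_fm \<AA> \<mu> (Ex x \<phi>) = One \<longleftrightarrow> (\<exists>a\<in>univ \<AA>. eval_fm \<AA> (\<mu>(x := a)) \<phi> = One)"
  using assms by (simp_all add: Min_tv_iff Max_tv_iff image_iff) metis+

declare eval_fm.simps(7,8) [simp del]

lemma tm_over_of_subst_tm: "x \<in> vars_tm s \<Longrightarrow> tm_over \<Theta> (subst_tm x t s) \<Longrightarrow> tm_over \<Theta> t"
  by (induction s) (auto simp: list_all_iff)

lemma tm_over_of_subst: "x \<in> fv \<phi> \<Longrightarrow> fm_over \<Theta> (subst x t \<phi>) \<Longrightarrow> tm_over \<Theta> t"
  by (induction \<phi>) (auto simp: list_all_iff split: if_splits dest: tm_over_of_subst_tm)

text \<open>If \<open>x\<close> is free in \<phi>, then \<open>t\<close> occurs in the instance,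
  hence is a term over \<Theta> and has its value in the domain. If not, \<open>t\<close> may be any
  raw term, but the update at \<open>x\<close> is invisible and \<open>\<mu> x\<close>
  serves.\<close>

lemma eval_subst_witness:
  assumes "is_struct \<Theta> \<AA>" "\<mu> \<in> assignments \<AA>" "free_for t x \<phi>" "fm_over \<Theta> (subst x t \<phi>)"
  shows "\<exists>a\<in>univ \<AA>. eval_fm \<AA> \<mu> (subst x t \<phi>) = eval_fm \<AA> (\<mu>(x := a)) \<phi>"
proof (cases "x \<in> fv \<phi>")
  case True
  then show ?thesis
    using assms eval_subst eval_tm_in_univ tm_over_of_subst by metis
next
  case False
  have "\<mu> x \<in> univ \<AA>"
    using assms(2) by (auto simp: assignments_def)
  then show ?thesis
    using False by (intro bexI[of _ "\<mu> x"]) auto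
qed

lemma axiom_sound:
  assumes "QLFI1_axiom \<phi>" "is_struct \<Theta> \<AA>" "\<phi> \<in> For \<Theta>"
  shows "valid_in \<AA> \<phi>"
  unfolding valid_in_def
proof
  fix \<mu>
  assume \<mu>: "\<mu> \<in> assignments \<AA>"
  have ne: "univ \<AA> \<noteq> {}"
    using assms(2) by (simp add: is_struct_def)
  note qs = eval_quant_iff[OF ne]
  show "eval_fm \<AA> \<mu> \<phi> \<noteq> Zero"
    using assms(1) assms(3)
  proof cases
    case (Ax12 t x \<psi>)
    then have "\<exists>a\<in>univ \<AA>. eval_fm \<AA> \<mu> (subst x t \<psi>) = eval_fm \<AA> (\<mu>(x := a)) \<psi>"
      using assms \<mu> by (intro eval_subst_witness) (auto simp: For_def)
    then show ?thesis
      using Ax12 by (auto simp: qs tv_iffs)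
  next
    case (Ax13 t x \<psi>)
    then have "\<exists>a\<in>univ \<AA>. eval_fm \<AA> \<mu> (subst x t \<psi>) = eval_fm \<AA> (\<mu>(x := a)) \<psi>"
      using assms \<mu> by (intro eval_subst_witness) (auto simp: For_def)
    then show ?thesis
      using Ax13 by (simp add: qs tv_iffs) metis
  qed (auto simp: tv_iffs qs)
qed

text \<open>The induction hypothesis speaks of all assignments, so it covers the updates at
  \<open>x\<close> that a quantifier rule calls for, whether or not \<open>x\<close> is free in
  \<Gamma>.\<close>

lemma prv_sound:
  assumes "prv (For \<Theta>) \<Gamma> \<phi>" "is_struct \<Theta> \<AA>" "\<forall>\<gamma>\<in>\<Gamma>. valid_in \<AA> \<gamma>"
  shows "valid_in \<AA> \<phi>"
  using assms(1)
proof (induction rule: prv.induct)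
  case (ax \<phi>)
  then show ?case using axiom_sound assms(2) by blast
next
  case (hyp \<phi>)
  then show ?case using assms(3) by blast
next
  case (mp \<phi> \<psi>)
  then show ?case by (auto simp: valid_in_def tv_iffs)
next
  case (ex_intro \<phi> \<psi> x)
  have ne: "univ \<AA> \<noteq> {}"
    using assms(2) by (simp add: is_struct_def)
  show ?case
    unfolding valid_in_def
  proof
    fix \<mu>
    assume \<mu>: "\<mu> \<in> assignments \<AA>"
    have "eval_fm \<AA> (\<mu>(x := a)) \<psi> = eval_fm \<AA> \<mu> \<psi>" for a
      using ex_intro by (intro eval_fm_cong) auto
    moreover have "eval_fm \<AA> (\<mu>(x := a)) (Imp \<phi> \<psi>) \<noteq> Zero" if "a \<in> univ \<AA>" for a
      using ex_intro \<mu> that by (auto simp: valid_in_def upd_assignments)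
    ultimately show "eval_fm \<AA> \<mu> (Imp (Ex x \<phi>) \<psi>) \<noteq> Zero"
      by (auto simp: tv_iffs eval_quant_iff[OF ne])
  qed
next
  case (all_intro \<phi> \<psi> x)
  have ne: "univ \<AA> \<noteq> {}"
    using assms(2) by (simp add: is_struct_def)
  show ?case
    unfolding valid_in_def
  proof
    fix \<mu>
    assume \<mu>: "\<mu> \<in> assignments \<AA>"
    have "eval_fm \<AA> (\<mu>(x := a)) \<phi> = eval_fm \<AA> \<mu> \<phi>" for a
      using all_intro by (intro eval_fm_cong) auto
    moreover have "eval_fm \<AA> (\<mu>(x := a)) (Imp \<phi> \<psi>) \<noteq> Zero" if "a \<in> univ \<AA>" for a
      using all_intro \<mu> that by (auto simp: valid_in_def upd_assignments)
    ultimately show "eval_fm \<AA> \<mu> (Imp \<phi> (All x \<psi>)) \<noteq> Zero"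
      by (auto simp: tv_iffs eval_quant_iff[OF ne])
  qed
qed

section \<open>Propositional reasoning inside the calculus\<close>

text \<open>Derivability from \<open>H\<close> by modus ponens alone: here the deduction theorem holds
  for open formulas, too.\<close>

inductive nd :: "('c, 'f, 'p) fm set \<Rightarrow> ('c, 'f, 'p) fm set \<Rightarrow> ('c, 'f, 'p) fm \<Rightarrow> bool"
  for \<Gamma> H where
  nd_prv: "prv UNIV \<Gamma> \<alpha> \<Longrightarrow> nd \<Gamma> H \<alpha>"
| nd_hyp: "\<alpha> \<in> H \<Longrightarrow> nd \<Gamma> H \<alpha>"
| nd_mp: "nd \<Gamma> H (Imp \<alpha> \<beta>) \<Longrightarrow> nd \<Gamma> H \<alpha> \<Longrightarrow> nd \<Gamma> H \<beta>"

lemma prv_ax: "QLFI1_axiom \<alpha> \<Longrightarrow> prv UNIV \<Gamma> \<alpha>"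
  by (simp add: prv.ax)

lemma prv_mp: "prv UNIV \<Gamma> (Imp \<alpha> \<beta>) \<Longrightarrow> prv UNIV \<Gamma> \<alpha> \<Longrightarrow> prv UNIV \<Gamma> \<beta>"
  by (erule prv.mp) auto

lemma nd_ax: "QLFI1_axiom \<alpha> \<Longrightarrow> nd \<Gamma> H \<alpha>"
  by (simp add: nd_prv prv_ax)

lemma nd_emptyD: "nd \<Gamma> {} \<alpha> \<Longrightarrow> prv UNIV \<Gamma> \<alpha>"
  by (induction rule: nd.induct) (auto intro: prv_mp)

lemma nd_impI: "nd \<Gamma> (insert \<alpha> H) \<beta> \<Longrightarrow> nd \<Gamma> H (Imp \<alpha> \<beta>)"
proof (induction rule: nd.induct)
  case (nd_prv \<beta>)
  show ?case
    by (rule nd_mp[OF nd_ax[OF A1] nd.nd_prv[OF nd_prv]])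
next
  case (nd_hyp \<beta>)
  show ?case
  proof (cases "\<beta> = \<alpha>")
    case True
    \<comment> \<open>This is \<alpha> \<rightarrow> \<alpha> from (A1) and (A2), with \<alpha>
      \<rightarrow> \<alpha> itself as the middle formula.\<close>
    then show ?thesis
      using nd_mp[OF nd_mp[OF nd_ax[OF A2[where \<beta> = "Imp \<alpha> \<alpha>"]] nd_ax[OF A1]] nd_ax[OF A1]] by simp
  next
    case False
    then have "nd \<Gamma> H \<beta>"
      using nd_hyp by (auto intro: nd.nd_hyp)
    then show ?thesis
      by (rule nd_mp[OF nd_ax[OF A1]])
  qed
next
  case (nd_mp \<beta> \<gamma>)
  show ?case
    by (rule nd.nd_mp[OF nd.nd_mp[OF nd_ax[OF A2] nd_mp.IH(1)] nd_mp.IH(2)])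
qed

text \<open>(A8) and (A9) give the classical dichotomy of this logic: \<alpha> holds, or it implies
  any chosen \<beta>. Each use picks \<beta> to suit its goal.\<close>

lemma nd_cases:
  assumes "nd \<Gamma> (insert \<alpha> H) \<gamma>" "nd \<Gamma> (insert (Imp \<alpha> \<beta>) H) \<gamma>"
  shows "nd \<Gamma> H \<gamma>"
  using nd_mp[OF nd_mp[OF nd_mp[OF nd_ax[OF A8] nd_impI[OF assms(1)]] nd_impI[OF assms(2)]]
      nd_ax[OF A9]] .

text \<open>Serves, with the next two lemmas, the quantifier cases of the deduction theorem: the
  extra hypothesis has to be moved until the quantified formula is the outermost antecedent
  (\<exists>) or the consequent of a single implication (\<forall>).\<close>

lemma prv_swap:
  assumes "prv UNIV \<Gamma> (Imp \<alpha> (Imp \<beta> \<gamma>))"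
  shows "prv UNIV \<Gamma> (Imp \<beta> (Imp \<alpha> \<gamma>))"
proof -
  let ?H = "{\<alpha>, \<beta>}"
  have "nd \<Gamma> ?H \<gamma>"
    by (rule nd_mp[OF nd_mp[OF nd_prv[OF assms]]]) (auto intro: nd_hyp)
  then show ?thesis
    by (intro nd_emptyD nd_impI)
qed

lemma prv_uncurry:
  assumes "prv UNIV \<Gamma> (Imp \<alpha> (Imp \<beta> \<gamma>))"
  shows "prv UNIV \<Gamma> (Imp (And \<alpha> \<beta>) \<gamma>)"
proof -
  let ?H = "{And \<alpha> \<beta>}"
  have conj: "nd \<Gamma> ?H (And \<alpha> \<beta>)"
    by (auto intro: nd_hyp)
  have "nd \<Gamma> ?H \<gamma>"
    by (rule nd_mp[OF nd_mp[OF nd_prv[OF assms]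
          nd_mp[OF nd_ax[OF A4] conj]] nd_mp[OF nd_ax[OF A5] conj]])
  then show ?thesis
    by (intro nd_emptyD nd_impI)
qed

lemma prv_curry:
  assumes "prv UNIV \<Gamma> (Imp (And \<alpha> \<beta>) \<gamma>)"
  shows "prv UNIV \<Gamma> (Imp \<alpha> (Imp \<beta> \<gamma>))"
proof -
  let ?H = "{\<beta>, \<alpha>}"
  have "nd \<Gamma> ?H \<alpha>" "nd \<Gamma> ?H \<beta>"
    by (auto intro: nd_hyp)
  then have "nd \<Gamma> ?H \<gamma>"
    by (rule nd_mp[OF nd_prv[OF assms] nd_mp[OF nd_mp[OF nd_ax[OF A3]]]])
  then show ?thesis
    by (intro nd_emptyD nd_impI)
qed

text \<open>After the rearrangement \<alpha> is part of the formula in which \<open>x\<close> must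
  not be free; closedness of \<alpha> preserves this side condition.\<close>

lemma prv_deduction:
  assumes "prv UNIV (insert \<alpha> \<Gamma>) \<beta>" "fv \<alpha> = {}"
  shows "prv UNIV \<Gamma> (Imp \<alpha> \<beta>)"
  using assms(1)
proof (induction rule: prv.induct)
  case (ax \<phi>)
  then show ?case using prv_mp[OF prv_ax[OF A1] prv_ax] by blast
next
  case (hyp \<phi>)
  then have "nd \<Gamma> {\<alpha>} \<phi>"
    by (cases "\<phi> = \<alpha>") (auto intro: nd_hyp nd_prv prv.hyp)
  then show ?case
    by (intro nd_emptyD nd_impI)
next
  case (mp \<phi> \<psi>)
  show ?case by (rule prv_mp[OF prv_mp[OF prv_ax[OF A2] mp.IH(1)] mp.IH(2)])
next
  case (ex_intro \<phi> \<psi> x)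
  have "prv UNIV \<Gamma> (Imp (Ex x \<phi>) (Imp \<alpha> \<psi>))"
    using assms(2) ex_intro.hyps by (intro prv.ex_intro prv_swap[OF ex_intro.IH]) auto
  then show ?case
    by (rule prv_swap)
next
  case (all_intro \<phi> \<psi> x)
  have "prv UNIV \<Gamma> (Imp (And \<alpha> \<phi>) (All x \<psi>))"
    using assms(2) all_intro.hyps by (intro prv.all_intro prv_uncurry[OF all_intro.IH]) auto
  then show ?case
    by (rule prv_curry)
qed

lemma prv_mono: "prv F \<Gamma> \<phi> \<Longrightarrow> \<Gamma> \<subseteq> \<Gamma>' \<Longrightarrow> prv F \<Gamma>' \<phi>"
  by (induction rule: prv.induct) (auto intro: prv.intros)

lemma prv_compact: "prv F \<Gamma> \<phi> \<Longrightarrow> \<exists>\<Gamma>0\<subseteq>\<Gamma>. finite \<Gamma>0 \<and> prv F \<Gamma>0 \<phi>"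
proof (induction rule: prv.induct)
  case (ax \<phi>)
  then show ?case by (intro exI[of _ "{}"]) (auto intro: prv.ax)
next
  case (hyp \<phi>)
  then show ?case by (intro exI[of _ "{\<phi>}"]) (auto intro: prv.hyp)
next
  case (mp \<phi> \<psi>)
  then obtain A B where "A \<subseteq> \<Gamma>" "finite A" "prv F A (Imp \<phi> \<psi>)" "B \<subseteq> \<Gamma>" "finite B" "prv F B \<phi>"
    by blast
  moreover from this have "prv F (A \<union> B) (Imp \<phi> \<psi>)" "prv F (A \<union> B) \<phi>"
    by (auto elim: prv_mono)
  ultimately show ?case
    using mp.hyps by (intro exI[of _ "A \<union> B"]) (auto intro: prv.mp)
next
  case (ex_intro \<phi> \<psi> x)
  then show ?case by (meson prv.ex_intro)
next
  case (all_intro \<phi> \<psi> x)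
  then show ?case by (meson prv.all_intro)
qed

text \<open>Generalisation is not a rule of the calculus, but \<forall>-In applied to an implication
  from a closed theorem yields it.\<close>

lemma prv_All_iff: "prv UNIV \<Gamma> (All x \<phi>) \<longleftrightarrow> prv UNIV \<Gamma> \<phi>"
proof
  assume "prv UNIV \<Gamma> (All x \<phi>)"
  moreover have "QLFI1_axiom (Imp (All x \<phi>) (subst x (Var x) \<phi>))"
    by (rule Ax13) simp
  ultimately show "prv UNIV \<Gamma> \<phi>"
    using prv_mp[OF prv_ax] by simp
next
  assume "prv UNIV \<Gamma> \<phi>"
  \<comment> \<open>An atom without arguments has no variables, so this instance of (A1) is a
    sentence; the raw syntax admits such atoms.\<close>
  define \<theta> :: "('a, 'b, 'c) fm" where "\<theta> = Imp (Pred undefined []) (Imp (Pred undefined []) (Pred undefined []))"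
  have "prv UNIV \<Gamma> (Imp \<theta> \<phi>)"
    using \<open>prv UNIV \<Gamma> \<phi>\<close> by (rule prv_mp[OF prv_ax[OF A1]])
  then have "prv UNIV \<Gamma> (Imp \<theta> (All x \<phi>))"
    by (rule prv.all_intro) (auto simp: \<theta>_def)
  moreover have "prv UNIV \<Gamma> \<theta>"
    unfolding \<theta>_def by (rule prv_ax[OF A1])
  ultimately show "prv UNIV \<Gamma> (All x \<phi>)"
    by (rule prv_mp)
qed

text \<open>Without classical negation the argument splits on implications into A =
  \<forall>x\<phi>. Let D be the goal. Either D or D \<rightarrow> A. In the second case \<phi>
  follows by splitting into \<phi> and \<phi> \<rightarrow> A, since the latter gives D, hence A,
  hence \<phi>. Generalising yields A, so \<phi> \<rightarrow> A and again D.\<close>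

lemma prv_drinker: "prv UNIV \<Gamma> (Ex x (Imp \<phi> (All x \<phi>)))"
proof -
  let ?A = "All x \<phi>"
  let ?D = "Ex x (Imp \<phi> ?A)"
  have D: "nd \<Gamma> H (Imp (Imp \<phi> ?A) ?D)" for H
    using nd_ax[OF Ax12[OF free_for_Var[of x "Imp \<phi> ?A"]]] by (metis subst_Var)
  have A: "nd \<Gamma> H (Imp ?A \<phi>)" for H
    using nd_ax[OF Ax13[OF free_for_Var[of x \<phi>]]] by (metis subst_Var)
  have "nd \<Gamma> {Imp ?D ?A} \<phi>"
  proof (rule nd_cases[of _ \<phi> _ _ ?A])
    show "nd \<Gamma> {\<phi>, Imp ?D ?A} \<phi>"
      by (simp add: nd_hyp)
    have "nd \<Gamma> {Imp \<phi> ?A, Imp ?D ?A} ?A"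
      by (rule nd_mp[OF nd_hyp nd_mp[OF D nd_hyp]]) auto
    then show "nd \<Gamma> {Imp \<phi> ?A, Imp ?D ?A} \<phi>"
      by (rule nd_mp[OF A])
  qed
  \<comment> \<open>\<open>x\<close> is bound in both formulas of the antecedent, so \<forall>-In
    applies.\<close>
  then have "prv UNIV \<Gamma> (Imp (Imp ?D ?A) ?A)"
    by (intro prv.all_intro nd_emptyD nd_impI) auto
  then have *: "nd \<Gamma> {Imp ?D ?A} ?A"
    by (rule nd_mp[OF nd_prv nd_hyp]) simp
  show ?thesis
  proof (rule nd_emptyD, rule nd_cases[of _ ?D _ _ ?A])
    show "nd \<Gamma> {?D} ?D"
      by (simp add: nd_hyp)
    show "nd \<Gamma> {Imp ?D ?A} ?D"
      by (rule nd_mp[OF D nd_mp[OF nd_ax[OF A1] *]])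
  qed
qed


section \<open>Translation of derivations\<close>

primrec bv :: "('c, 'f, 'p) fm \<Rightarrow> nat set" where
  "bv (Pred P ts) = {}"
| "bv (And \<alpha> \<beta>) = bv \<alpha> \<union> bv \<beta>"
| "bv (Or \<alpha> \<beta>) = bv \<alpha> \<union> bv \<beta>"
| "bv (Imp \<alpha> \<beta>) = bv \<alpha> \<union> bv \<beta>"
| "bv (Neg \<alpha>) = bv \<alpha>"
| "bv (Circ \<alpha>) = bv \<alpha>"
| "bv (All x \<alpha>) = insert x (bv \<alpha>)"
| "bv (Ex x \<alpha>) = insert x (bv \<alpha>)"

lemma finite_bv [simp]: "finite (bv \<phi>)"
  by (induction \<phi>) auto

lemma finite_vars_tm [simp]: "finite (vars_tm t)"
  by (induction t) auto

lemma finite_fv [simp]: "finite (fv \<phi>)"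
  by (induction \<phi>) auto

text \<open>Unwanted constants and terms become one variable \<open>y\<close>, unwanted atoms become a fixed
  atom.  Derivations are preserved as soon as \<open>y\<close> avoids the finitely many variables that
  occur in them.\<close>

context
  fixes cm :: "'d \<Rightarrow> 'c option"
    and okf :: "'f \<Rightarrow> nat \<Rightarrow> bool"
    and okp :: "'p \<Rightarrow> nat \<Rightarrow> bool"
    and pf :: 'p
    and nf :: nat
begin

primrec tr_tm :: "nat \<Rightarrow> ('d, 'f) tm \<Rightarrow> ('c, 'f) tm" where
  "tr_tm y (Var x) = Var x"
| "tr_tm y (Const d) = (case cm d of None \<Rightarrow> Var y | Some c \<Rightarrow> Const c)"
| "tr_tm y (Fun f ts) = (if okf f (length ts) then Fun f (map (tr_tm y) ts) else Var y)"

primrec tr_fm :: "nat \<Rightarrow> ('d, 'f, 'p) fm \<Rightarrow> ('c, 'f, 'p) fm" where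
  "tr_fm y (Pred P ts) =
     (if okp P (length ts) then Pred P (map (tr_tm y) ts) else Pred pf (replicate nf (Var y)))"
| "tr_fm y (And \<alpha> \<beta>) = And (tr_fm y \<alpha>) (tr_fm y \<beta>)"
| "tr_fm y (Or \<alpha> \<beta>) = Or (tr_fm y \<alpha>) (tr_fm y \<beta>)"
| "tr_fm y (Imp \<alpha> \<beta>) = Imp (tr_fm y \<alpha>) (tr_fm y \<beta>)"
| "tr_fm y (Neg \<alpha>) = Neg (tr_fm y \<alpha>)"
| "tr_fm y (Circ \<alpha>) = Circ (tr_fm y \<alpha>)"
| "tr_fm y (All x \<alpha>) = All x (tr_fm y \<alpha>)"
| "tr_fm y (Ex x \<alpha>) = Ex x (tr_fm y \<alpha>)"

lemma vars_tr_tm: "vars_tm (tr_tm y t) \<subseteq> insert y (vars_tm t)"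
  by (induction t) (auto split: option.split)

lemma fv_tr_fm: "fv (tr_fm y \<phi>) \<subseteq> insert y (fv \<phi>)"
proof (induction \<phi>)
  case (Pred P ts)
  then show ?case using vars_tr_tm by (auto simp: subset_iff)
qed auto

lemma tr_subst_tm: "x \<noteq> y \<Longrightarrow> tr_tm y (subst_tm x t s) = subst_tm x (tr_tm y t) (tr_tm y s)"
  by (induction s) (auto split: option.split)

lemma tr_subst: "x \<noteq> y \<Longrightarrow> tr_fm y (subst x t \<phi>) = subst x (tr_tm y t) (tr_fm y \<phi>)"
  by (induction \<phi>) (auto simp: tr_subst_tm)

lemma tr_free_for:
  "free_for t x \<phi> \<Longrightarrow> x \<noteq> y \<Longrightarrow> y \<notin> bv \<phi> \<Longrightarrow> free_for (tr_tm y t) x (tr_fm y \<phi>)"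
proof (induction \<phi>)
  case (All z \<phi>)
  then show ?case using vars_tr_tm[of y t] fv_tr_fm[of y \<phi>] by auto
next
  case (Ex z \<phi>)
  then show ?case using vars_tr_tm[of y t] fv_tr_fm[of y \<phi>] by auto
qed auto

text \<open>Two accidents threaten Ax12 and Ax13. If \<open>y\<close> were \<open>x\<close>, the
  substitution would also hit the inserted copies of \<open>y\<close>. If \<open>y\<close> were
  bound in \<psi>, a \<open>y\<close> inserted into \<open>t\<close> could be captured.\<close>

lemma tr_axiom:
  assumes "QLFI1_axiom \<phi>"
  shows "\<exists>V. finite V \<and> (\<forall>y. y \<notin> V \<longrightarrow> QLFI1_axiom (tr_fm y \<phi>))"
  using assms
proof cases
  case (Ax12 t x \<psi>)
  have "QLFI1_axiom (tr_fm y \<phi>)" if "y \<notin> insert x (bv \<psi>)" for y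
    using Ax12 that by (auto simp: tr_subst intro: QLFI1_axiom.Ax12 tr_free_for)
  then show ?thesis by (intro exI[of _ "insert x (bv \<psi>)"]) simp
next
  case (Ax13 t x \<psi>)
  have "QLFI1_axiom (tr_fm y \<phi>)" if "y \<notin> insert x (bv \<psi>)" for y
    using Ax13 that by (auto simp: tr_subst intro: QLFI1_axiom.Ax13 tr_free_for)
  then show ?thesis by (intro exI[of _ "insert x (bv \<psi>)"]) simp
qed (auto intro!: exI[of _ "{}"] QLFI1_axiom.intros(1-16,19-20))

text \<open>The forbidden variables accumulate along the derivation, so \<open>y\<close> can be
  chosen only afterwards, outside a finite set. In both applications the translated hypotheses do
  not depend on \<open>y\<close>.\<close>

lemma tr_prv:
  assumes "prv UNIV \<Gamma> \<phi>" and F: "\<And>y \<phi>. tr_fm y \<phi> \<in> F"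
  shows "\<exists>V. finite V \<and> (\<forall>y. y \<notin> V \<longrightarrow> prv F (tr_fm y ` \<Gamma>) (tr_fm y \<phi>))"
  using assms(1)
proof (induction rule: prv.induct)
  case (ax \<phi>)
  then show ?case using tr_axiom F prv.ax by metis
next
  case (hyp \<phi>)
  then show ?case using F by (intro exI[of _ "{}"]) (auto intro: prv.hyp)
next
  case (mp \<phi> \<psi>)
  then obtain V W where "finite V" "finite W"
    and V: "\<And>y. y \<notin> V \<Longrightarrow> prv F (tr_fm y ` \<Gamma>) (tr_fm y (Imp \<phi> \<psi>))"
    and W: "\<And>y. y \<notin> W \<Longrightarrow> prv F (tr_fm y ` \<Gamma>) (tr_fm y \<phi>)"
    by blast
  have "prv F (tr_fm y ` \<Gamma>) (tr_fm y \<psi>)" if "y \<notin> V \<union> W" for y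
    using V[of y] W[of y] that F by (auto intro: prv.mp)
  then show ?case
    using \<open>finite V\<close> \<open>finite W\<close> by (intro exI[of _ "V \<union> W"]) simp
next
  case (ex_intro \<phi> \<psi> x)
  then obtain V where "finite V"
    and V: "\<And>y. y \<notin> V \<Longrightarrow> prv F (tr_fm y ` \<Gamma>) (tr_fm y (Imp \<phi> \<psi>))"
    by blast
  have "prv F (tr_fm y ` \<Gamma>) (tr_fm y (Imp (Ex x \<phi>) \<psi>))" if "y \<notin> insert x V" for y
    using V[of y] that F[of y "Imp (Ex x \<phi>) \<psi>"] fv_tr_fm[of y \<psi>] ex_intro.hyps
    by (auto intro!: prv.ex_intro)
  then show ?case
    using \<open>finite V\<close> by (intro exI[of _ "insert x V"]) simp
next
  case (all_intro \<phi> \<psi> x)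
  then obtain V where "finite V"
    and V: "\<And>y. y \<notin> V \<Longrightarrow> prv F (tr_fm y ` \<Gamma>) (tr_fm y (Imp \<phi> \<psi>))"
    by blast
  have "prv F (tr_fm y ` \<Gamma>) (tr_fm y (Imp \<phi> (All x \<psi>)))" if "y \<notin> insert x V" for y
    using V[of y] that F[of y "Imp \<phi> (All x \<psi>)"] fv_tr_fm[of y \<phi>] all_intro.hyps
    by (auto intro!: prv.all_intro)
  then show ?case
    using \<open>finite V\<close> by (intro exI[of _ "insert x V"]) simp
qed

end


section \<open>Conservativity of Henkin axioms\<close>

abbreviation abs_const_tm :: "'c \<Rightarrow> nat \<Rightarrow> ('c, 'f) tm \<Rightarrow> ('c, 'f) tm" where
  "abs_const_tm c \<equiv> tr_tm (\<lambda>d. if d = c then None else Some d) (\<lambda>_ _. True)"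

abbreviation abs_const :: "'c \<Rightarrow> nat \<Rightarrow> ('c, 'f, 'p) fm \<Rightarrow> ('c, 'f, 'p) fm" where
  "abs_const c \<equiv>
     tr_fm (\<lambda>d. if d = c then None else Some d) (\<lambda>_ _. True) (\<lambda>_ _. True) undefined 0"

lemma abs_const_tm_id: "c \<notin> set1_tm t \<Longrightarrow> abs_const_tm c y t = t"
  by (induction t) (auto simp: map_idI)

lemma abs_const_id: "c \<notin> set1_fm \<phi> \<Longrightarrow> abs_const c y \<phi> = \<phi>"
  by (induction \<phi>) (auto simp: map_idI abs_const_tm_id)

lemma subst_tm_rename: "y \<notin> vars_tm t \<Longrightarrow> subst_tm y (Var x) (subst_tm x (Var y) t) = t"
  by (induction t) (auto simp: map_idI)

lemma subst_rename: "y \<notin> fv \<phi> \<union> bv \<phi> \<Longrightarrow> subst y (Var x) (subst x (Var y) \<phi>) = \<phi>"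
  by (induction \<phi>) (auto simp: map_idI subst_tm_rename)

lemma free_for_rename: "y \<notin> fv \<phi> \<union> bv \<phi> \<Longrightarrow> free_for (Var x) y (subst x (Var y) \<phi>)"
  by (induction \<phi>) auto

text \<open>The fresh \<open>c\<close> is generalised to a variable \<open>y\<close>, so
  (\<exists>x\<phi> \<rightarrow> \<phi>[x/y]) \<rightarrow> \<psi> is derivable. Its antecedent
  follows from \<phi>[x/y], whence \<exists>x\<phi> \<rightarrow> \<psi> after renaming. By (A9)
  either \<exists>x\<phi> or \<exists>x\<phi> \<rightarrow> \<phi>[x/y], and both give
  \<psi>.\<close>

lemma henkin_step:
  assumes prv: "prv UNIV (insert (Imp (Ex x \<phi>) (subst x (Const c) \<phi>)) \<Gamma>) \<psi>"
    and fv: "fv (Imp (Ex x \<phi>) (subst x (Const c) \<phi>)) = {}" "fv \<psi> = {}"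
    and c: "c \<notin> set1_fm \<phi>" "c \<notin> set1_fm \<psi>" "\<And>\<gamma>. \<gamma> \<in> \<Gamma> \<Longrightarrow> c \<notin> set1_fm \<gamma>"
  shows "prv UNIV \<Gamma> \<psi>"
proof -
  have "prv UNIV \<Gamma> (Imp (Imp (Ex x \<phi>) (subst x (Const c) \<phi>)) \<psi>)"
    using prv fv(1) by (rule prv_deduction)
  note tr_prv[OF this, where F = UNIV and cm = "\<lambda>d. if d = c then None else Some d"
      and okf = "\<lambda>_ _. True" and okp = "\<lambda>_ _. True" and pf = undefined and nf = 0, OF UNIV_I]
  then obtain V where V: "finite V"
    "\<forall>y. y \<notin> V \<longrightarrow> prv UNIV (abs_const c y ` \<Gamma>)
       (abs_const c y (Imp (Imp (Ex x \<phi>) (subst x (Const c) \<phi>)) \<psi>))"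
    by (elim exE conjE)
  obtain y where y: "y \<notin> V \<union> fv \<phi> \<union> bv \<phi> \<union> {x}"
    using ex_new_if_finite[of "V \<union> fv \<phi> \<union> bv \<phi> \<union> {x}"] V(1) by auto
  let ?\<phi> = "subst x (Var y) \<phi>"
  have "abs_const c y ` \<Gamma> = \<Gamma>"
    using c(3) by (simp add: abs_const_id cong: image_cong_simp)
  moreover have "x \<noteq> y"
    using y by blast
  ultimately have imp: "prv UNIV \<Gamma> (Imp (Imp (Ex x \<phi>) ?\<phi>) \<psi>)"
    using V(2)[rule_format, of y] y c by (simp add: abs_const_id tr_subst)
  have "nd \<Gamma> {?\<phi>} \<psi>"
    by (rule nd_mp[OF nd_prv[OF imp] nd_mp[OF nd_ax[OF A1] nd_hyp]]) simp
  then have ex_y: "prv UNIV \<Gamma> (Imp (Ex y ?\<phi>) \<psi>)"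
    using fv(2) by (intro prv.ex_intro nd_emptyD nd_impI) auto
  \<comment> \<open>Renaming of the bound variable: \<phi> is itself an instance of \<phi>[x/y], at
    the term \<open>x\<close>.\<close>
  have "QLFI1_axiom (Imp (subst y (Var x) ?\<phi>) (Ex y ?\<phi>))"
    using y by (intro Ax12 free_for_rename) auto
  then have "QLFI1_axiom (Imp \<phi> (Ex y ?\<phi>))"
    using y by (simp add: subst_rename)
  then have "nd \<Gamma> {\<phi>} (Ex y ?\<phi>)"
    by (rule nd_mp[OF nd_ax nd_hyp]) simp
  then have "nd \<Gamma> {\<phi>} \<psi>"
    by (rule nd_mp[OF nd_prv[OF ex_y]])
  then have ex: "prv UNIV \<Gamma> (Imp (Ex x \<phi>) \<psi>)"
    using fv(2) by (intro prv.ex_intro nd_emptyD nd_impI) auto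
  show ?thesis
  proof (rule nd_emptyD, rule nd_cases[of _ "Ex x \<phi>" _ _ ?\<phi>])
    show "nd \<Gamma> {Ex x \<phi>} \<psi>"
      by (rule nd_mp[OF nd_prv[OF ex] nd_hyp]) simp
    show "nd \<Gamma> {Imp (Ex x \<phi>) ?\<phi>} \<psi>"
      by (rule nd_mp[OF nd_prv[OF imp] nd_hyp]) simp
  qed
qed

text \<open>The Henkin constant \<open>Wit x \<phi>\<close> witnesses \<open>Ex x \<phi>\<close>, where \<open>\<phi>\<close> may itself contain
  Henkin constants: the nested datatype closes the language under witnesses in one step.\<close>

datatype ('c, 'f, 'p) hc = Old 'c | Wit nat "(('c, 'f, 'p) hc, 'f, 'p) fm"

lemma finite_set1_tm: "finite (set1_tm t)"
  by (induction t) auto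

lemma finite_set1_fm: "finite (set1_fm \<phi>)"
  by (induction \<phi>) (auto simp: finite_set1_tm)

text \<open>Nesting depth of witnesses. The recursion through \<open>fm\<close> goes via
  \<open>map_fm\<close>, so the depths of the constants of \<phi> appear as the constants of the
  mapped formula. On \<open>nat\<close> the empty \<open>Sup\<close> is 0.\<close>

primrec depth :: "('c, 'f, 'p) hc \<Rightarrow> nat" where
  "depth (Old c) = 0"
| "depth (Wit x \<phi>) = Suc (Sup (set1_fm (map_fm depth id id \<phi>)))"

lemma depth_less: "c \<in> set1_fm \<phi> \<Longrightarrow> depth c < depth (Wit x \<phi>)"
proof -
  assume "c \<in> set1_fm \<phi>"
  then have "depth c \<le> Sup (depth ` set1_fm \<phi>)"
    by (intro cSup_upper) (auto simp: finite_set1_fm)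
  then show ?thesis
    by (simp add: fm.set_map)
qed

definition henkin_axiom :: "nat \<times> (('c, 'f, 'p) hc, 'f, 'p) fm \<Rightarrow> (('c, 'f, 'p) hc, 'f, 'p) fm" where
  "henkin_axiom = (\<lambda>(x, \<phi>). Imp (Ex x \<phi>) (subst x (Const (Wit x \<phi>)) \<phi>))"

text \<open>Only \<phi> with at most \<open>x\<close> free get a witness axiom, so these axioms are
  sentences and the deduction theorem can discharge them.\<close>

definition henkin_axioms :: "(('c, 'f, 'p) hc, 'f, 'p) fm set" where
  "henkin_axioms = henkin_axiom ` {(x, \<phi>). fv \<phi> \<subseteq> {x}}"

lemma set1_subst_tm: "set1_tm (subst_tm x t s) \<subseteq> set1_tm t \<union> set1_tm s"
  by (induction s) auto

lemma set1_subst: "set1_fm (subst x t \<phi>) \<subseteq> set1_tm t \<union> set1_fm \<phi>"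
  by (induction \<phi>) (auto dest!: subsetD[OF set1_subst_tm])

lemma vars_subst_tm: "vars_tm (subst_tm x t s) \<subseteq> vars_tm t \<union> (vars_tm s - {x})"
  by (induction s) auto

lemma fv_subst: "fv (subst x t \<phi>) \<subseteq> vars_tm t \<union> (fv \<phi> - {x})"
  by (induction \<phi>) (auto dest!: subsetD[OF vars_subst_tm])

lemma fv_henkin_axiom: "fv \<phi> \<subseteq> {x} \<Longrightarrow> fv (henkin_axiom (x, \<phi>)) = {}"
  using fv_subst[of x "Const (Wit x \<phi>)" \<phi>] by (auto simp: henkin_axiom_def)

text \<open>Henkin axioms are removed in order of decreasing depth of their constants, since the
  deepest constant does not occur in the other axioms.\<close>

lemma henkin_finite_conservative:
  fixes \<Gamma> :: "(('c, 'f, 'p) hc, 'f, 'p) fm set"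
  assumes "finite S" and "S \<subseteq> {(x, \<phi>). fv \<phi> \<subseteq> {x}}"
    and \<Gamma>: "\<And>\<gamma>. \<gamma> \<in> \<Gamma> \<Longrightarrow> set1_fm \<gamma> \<subseteq> range Old"
    and \<psi>: "fv \<psi> = {}" "set1_fm \<psi> \<subseteq> range Old"
    and "prv UNIV (\<Gamma> \<union> henkin_axiom ` S) \<psi>"
  shows "prv UNIV \<Gamma> \<psi>"
  using assms(1,2,6)
proof (induction S rule: finite_ranking_induct[where f = "\<lambda>(x, \<phi>). depth (Wit x \<phi>)"])
  case empty
  then show ?case by simp
next
  case (insert p S)
  obtain x \<phi> where p: "p = (x, \<phi>)"
    by (cases p)
  let ?c = "Wit x \<phi>"
  have "prv UNIV (\<Gamma> \<union> henkin_axiom ` S) \<psi>"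
  \<comment> \<open>The ranking induction adds an element of largest depth but does not promise that
    it is new.\<close>
  proof (cases "p \<in> S")
    case True
    then show ?thesis using insert.prems by (simp add: insert_absorb)
  next
    case False
    \<comment> \<open>Nested inside \<phi>', the constant would be less deep than
      \<open>Wit x' \<phi>'\<close>, against the maximal depth of \<open>p\<close>.\<close>
    have "?c \<notin> set1_fm (henkin_axiom (x', \<phi>'))" if "(x', \<phi>') \<in> S" for x' \<phi>'
    proof
      assume "?c \<in> set1_fm (henkin_axiom (x', \<phi>'))"
      then have "?c = Wit x' \<phi>' \<or> ?c \<in> set1_fm \<phi>'"
        using set1_subst[of x' "Const (Wit x' \<phi>')" \<phi>'] by (auto simp: henkin_axiom_def)
      moreover have "?c \<noteq> Wit x' \<phi>'"
        using False that p by auto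
      ultimately have "depth ?c < depth (Wit x' \<phi>')"
        using depth_less[of ?c \<phi>' x'] by blast
      then show False
        using insert.hyps(2)[OF that] p by simp
    qed
    moreover have "?c \<notin> set1_fm \<gamma>" if "\<gamma> \<in> \<Gamma>" for \<gamma>
      using \<Gamma>[OF that] by auto
    ultimately have "\<And>\<gamma>. \<gamma> \<in> \<Gamma> \<union> henkin_axiom ` S \<Longrightarrow> ?c \<notin> set1_fm \<gamma>"
      by auto
    moreover have "?c \<notin> set1_fm \<phi>"
      using depth_less[of ?c \<phi> x] by auto
    moreover have "?c \<notin> set1_fm \<psi>"
      using \<psi>(2) by auto
    moreover have "fv (Imp (Ex x \<phi>) (subst x (Const ?c) \<phi>)) = {}"
      using insert.prems(1) p fv_henkin_axiom[of \<phi> x] by (simp add: henkin_axiom_def)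
    moreover have "prv UNIV (insert (Imp (Ex x \<phi>) (subst x (Const ?c) \<phi>)) (\<Gamma> \<union> henkin_axiom ` S)) \<psi>"
      using insert.prems(2) by (simp add: p henkin_axiom_def)
    ultimately show ?thesis
      using \<psi>(1) henkin_step[of x \<phi> ?c "\<Gamma> \<union> henkin_axiom ` S" \<psi>] by simp
  qed
  then show ?case
    using insert.IH insert.prems(1) by simp
qed

lemma henkin_conservative:
  assumes "prv UNIV (\<Gamma> \<union> henkin_axioms) \<psi>" and "\<And>\<gamma>. \<gamma> \<in> \<Gamma> \<Longrightarrow> set1_fm \<gamma> \<subseteq> range Old"
    and "fv \<psi> = {}" "set1_fm \<psi> \<subseteq> range Old"
  shows "prv UNIV \<Gamma> \<psi>"
proof -
  obtain \<Gamma>0 where \<Gamma>0: "\<Gamma>0 \<subseteq> \<Gamma> \<union> henkin_axioms" "finite \<Gamma>0" "prv UNIV \<Gamma>0 \<psi>"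
    using prv_compact[OF assms(1)] by blast
  then have "\<Gamma>0 - \<Gamma> \<subseteq> henkin_axiom ` {(x, \<phi>). fv \<phi> \<subseteq> {x}}" "finite (\<Gamma>0 - \<Gamma>)"
    unfolding henkin_axioms_def by auto
  then obtain S where S: "S \<subseteq> {(x, \<phi>). fv \<phi> \<subseteq> {x}}" "finite S" "\<Gamma>0 - \<Gamma> = henkin_axiom ` S"
    by (meson finite_subset_image)
  have "\<Gamma>0 \<subseteq> \<Gamma> \<union> henkin_axiom ` S"
    using S(3) by blast
  with \<Gamma>0(3) have "prv UNIV (\<Gamma> \<union> henkin_axiom ` S) \<psi>"
    by (rule prv_mono)
  then show ?thesis
    by (rule henkin_finite_conservative[OF S(2,1) assms(2-4), rotated])
qed


section \<open>Maximal theories and their term models\<close>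

text \<open>The union of a chain stays in the family because a derivation uses finitely many
  formulas, all found in one member. An underivable \<alpha> lies outside the maximal set, so adding
  it proves \<psi>, and the deduction theorem applies.\<close>

lemma lindenbaum:
  assumes "\<not> prv UNIV B \<psi>"
  obtains G where "B \<subseteq> G" "\<not> prv UNIV G \<psi>"
    "\<forall>\<alpha>. fv \<alpha> = {} \<longrightarrow> \<not> prv UNIV G \<alpha> \<longrightarrow> prv UNIV G (Imp \<alpha> \<psi>)"
proof -
  define A where "A = {D. \<not> prv UNIV (B \<union> D) \<psi>}"
  have "\<exists>M\<in>A. \<forall>X\<in>A. M \<subseteq> X \<longrightarrow> X = M"
  proof (rule subset_Zorn')
    fix C
    assume C: "subset.chain A C"
    show "\<Union>C \<in> A"
    proof (cases "C = {}")
      case True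
      then show ?thesis using assms by (simp add: A_def)
    next
      case False
      have "\<not> prv UNIV (B \<union> \<Union>C) \<psi>"
      proof
        assume "prv UNIV (B \<union> \<Union>C) \<psi>"
        from prv_compact[OF this] obtain \<Gamma>0
          where \<Gamma>0: "\<Gamma>0 \<subseteq> B \<union> \<Union>C" "finite \<Gamma>0" "prv UNIV \<Gamma>0 \<psi>"
          by blast
        then have "finite (\<Gamma>0 - B)" "\<Gamma>0 - B \<subseteq> \<Union>C"
          by auto
        then obtain D where "D \<in> C" "\<Gamma>0 - B \<subseteq> D"
          by (rule finite_subset_Union_chain[OF _ _ False C])
        then have "prv UNIV (B \<union> D) \<psi>"
          by (intro prv_mono[OF \<Gamma>0(3)]) auto
        moreover have "D \<in> A"
          using C \<open>D \<in> C\<close> by (auto simp: subset.chain_def)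
        ultimately show False
          by (simp add: A_def)
      qed
      then show ?thesis by (simp add: A_def)
    qed
  qed
  then obtain M where M: "M \<in> A" "\<forall>X\<in>A. M \<subseteq> X \<longrightarrow> X = M"
    by (rule bexE)
  show ?thesis
  proof
    show "B \<subseteq> B \<union> M" "\<not> prv UNIV (B \<union> M) \<psi>"
      using M(1) by (auto simp: A_def)
    show "\<forall>\<alpha>. fv \<alpha> = {} \<longrightarrow> \<not> prv UNIV (B \<union> M) \<alpha> \<longrightarrow> prv UNIV (B \<union> M) (Imp \<alpha> \<psi>)"
    proof (intro allI impI)
      fix \<alpha> :: "('a, 'b, 'c) fm"
      assume "fv \<alpha> = {}" "\<not> prv UNIV (B \<union> M) \<alpha>"
      then have "\<alpha> \<notin> M"
        using prv.hyp[of \<alpha> "B \<union> M" UNIV] by auto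
      then have "insert \<alpha> M \<notin> A"
        using M(2) by blast
      then have "prv UNIV (insert \<alpha> (B \<union> M)) \<psi>"
        by (simp add: A_def)
      then show "prv UNIV (B \<union> M) (Imp \<alpha> \<psi>)"
        using \<open>fv \<alpha> = {}\<close> by (rule prv_deduction)
    qed
  qed
qed

section \<open>Instantiating variables and renaming constants together\<close>

primrec inst_tm :: "('c \<Rightarrow> 'd) \<Rightarrow> (nat \<Rightarrow> ('d, 'f) tm) \<Rightarrow> ('c, 'f) tm \<Rightarrow> ('d, 'f) tm" where
  "inst_tm k \<sigma> (Var x) = \<sigma> x"
| "inst_tm k \<sigma> (Const c) = Const (k c)"
| "inst_tm k \<sigma> (Fun f ts) = Fun f (map (inst_tm k \<sigma>) ts)"

text \<open>With \<open>k = Old\<close> and \<open>\<sigma> = Var\<close> this embeds the original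
  language into the Henkin language; with closed \<sigma> it produces the sentence that the term
  model evaluates. Neither use can capture a variable, so bound variables are not renamed.\<close>

primrec inst :: "('c \<Rightarrow> 'd) \<Rightarrow> (nat \<Rightarrow> ('d, 'f) tm) \<Rightarrow> ('c, 'f, 'p) fm \<Rightarrow> ('d, 'f, 'p) fm" where
  "inst k \<sigma> (Pred P ts) = Pred P (map (inst_tm k \<sigma>) ts)"
| "inst k \<sigma> (And \<alpha> \<beta>) = And (inst k \<sigma> \<alpha>) (inst k \<sigma> \<beta>)"
| "inst k \<sigma> (Or \<alpha> \<beta>) = Or (inst k \<sigma> \<alpha>) (inst k \<sigma> \<beta>)"
| "inst k \<sigma> (Imp \<alpha> \<beta>) = Imp (inst k \<sigma> \<alpha>) (inst k \<sigma> \<beta>)"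
| "inst k \<sigma> (Neg \<alpha>) = Neg (inst k \<sigma> \<alpha>)"
| "inst k \<sigma> (Circ \<alpha>) = Circ (inst k \<sigma> \<alpha>)"
| "inst k \<sigma> (All x \<alpha>) = All x (inst k (\<sigma>(x := Var x)) \<alpha>)"
| "inst k \<sigma> (Ex x \<alpha>) = Ex x (inst k (\<sigma>(x := Var x)) \<alpha>)"

lemma inst_tm_cong: "(\<And>x. x \<in> vars_tm t \<Longrightarrow> \<sigma> x = \<tau> x) \<Longrightarrow> inst_tm k \<sigma> t = inst_tm k \<tau> t"
  by (induction t) auto

lemma inst_cong: "(\<And>x. x \<in> fv \<phi> \<Longrightarrow> \<sigma> x = \<tau> x) \<Longrightarrow> inst k \<sigma> \<phi> = inst k \<tau> \<phi>"
proof (induction \<phi> arbitrary: \<sigma> \<tau>)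
  case (Pred P ts)
  then show ?case by (auto intro: inst_tm_cong)
next
  case (And \<alpha> \<beta>)
  show ?case
    unfolding inst.simps fm.inject by (intro conjI And.IH And.prems) auto
next
  case (Or \<alpha> \<beta>)
  show ?case
    unfolding inst.simps fm.inject by (intro conjI Or.IH Or.prems) auto
next
  case (Imp \<alpha> \<beta>)
  show ?case
    unfolding inst.simps fm.inject by (intro conjI Imp.IH Imp.prems) auto
next
  case (Neg \<alpha>)
  show ?case
    unfolding inst.simps fm.inject by (intro Neg.IH Neg.prems) auto
next
  case (Circ \<alpha>)
  show ?case
    unfolding inst.simps fm.inject by (intro Circ.IH Circ.prems) auto
next
  case (All x \<phi>)
  have "inst k (\<sigma>(x := Var x)) \<phi> = inst k (\<tau>(x := Var x)) \<phi>"
    using All.prems by (intro All.IH) auto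
  then show ?case by simp
next
  case (Ex x \<phi>)
  have "inst k (\<sigma>(x := Var x)) \<phi> = inst k (\<tau>(x := Var x)) \<phi>"
    using Ex.prems by (intro Ex.IH) auto
  then show ?case by simp
qed

lemma vars_inst_tm: "(\<And>x. x \<in> vars_tm t \<Longrightarrow> vars_tm (\<sigma> x) \<subseteq> B) \<Longrightarrow> vars_tm (inst_tm k \<sigma> t) \<subseteq> B"
proof (induction t)
  case (Fun f ts)
  have "vars_tm (inst_tm k \<sigma> t) \<subseteq> B" if "t \<in> set ts" for t
    by (rule Fun.IH[OF that], rule Fun.prems) (use that in auto)
  then show ?case by auto
qed auto

lemma fv_inst: "(\<And>x. x \<in> fv \<phi> \<Longrightarrow> vars_tm (\<sigma> x) \<subseteq> B) \<Longrightarrow> fv (inst k \<sigma> \<phi>) \<subseteq> B"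
proof (induction \<phi> arbitrary: \<sigma> B)
  case (Pred P ts)
  have "vars_tm (inst_tm k \<sigma> t) \<subseteq> B" if "t \<in> set ts" for t
    using Pred that by (intro vars_inst_tm) auto
  then show ?case by auto
next
  case (And \<alpha> \<beta>)
  show ?case
    unfolding inst.simps fv.simps Un_subset_iff by (intro conjI And.IH And.prems) auto
next
  case (Or \<alpha> \<beta>)
  show ?case
    unfolding inst.simps fv.simps Un_subset_iff by (intro conjI Or.IH Or.prems) auto
next
  case (Imp \<alpha> \<beta>)
  show ?case
    unfolding inst.simps fv.simps Un_subset_iff by (intro conjI Imp.IH Imp.prems) auto
next
  case (Neg \<alpha>)
  show ?case
    unfolding inst.simps fv.simps by (intro Neg.IH Neg.prems) auto
next
  case (Circ \<alpha>)
  show ?case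
    unfolding inst.simps fv.simps by (intro Circ.IH Circ.prems) auto
next
  case (All x \<phi>)
  have "fv (inst k (\<sigma>(x := Var x)) \<phi>) \<subseteq> insert x B"
    using All.prems by (intro All.IH) auto
  then show ?case by auto
next
  case (Ex x \<phi>)
  have "fv (inst k (\<sigma>(x := Var x)) \<phi>) \<subseteq> insert x B"
    using Ex.prems by (intro Ex.IH) auto
  then show ?case by auto
qed

lemma fv_inst_closed: "(\<And>x. vars_tm (\<sigma> x) = {}) \<Longrightarrow> fv (inst k \<sigma> \<phi>) = {}"
  using fv_inst[of \<phi> \<sigma> "{}" k] by simp

lemma subst_inst_tm:
  "(\<And>z. z \<noteq> x \<Longrightarrow> x \<notin> vars_tm (\<sigma> z)) \<Longrightarrow>
     subst_tm x t (inst_tm k (\<sigma>(x := Var x)) s) = inst_tm k (\<sigma>(x := t)) s"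
  by (induction s) auto

text \<open>By the hypothesis, every free \<open>x\<close> after instantiation comes from the
  quantifier just opened. This is the syntactic counterpart of updating an assignment.\<close>

lemma subst_inst:
  "(\<And>z. z \<noteq> x \<Longrightarrow> x \<notin> vars_tm (\<sigma> z)) \<Longrightarrow>
     subst x t (inst k (\<sigma>(x := Var x)) \<phi>) = inst k (\<sigma>(x := t)) \<phi>"
proof (induction \<phi> arbitrary: \<sigma>)
  case (Pred P ts)
  then show ?case
    unfolding inst.simps subst.simps fm.inject map_map comp_def
    by (intro conjI map_cong refl subst_inst_tm)
next
  case (All y \<phi>)
  show ?case
  proof (cases "y = x")
    case False
    then have "subst x t (inst k ((\<sigma>(y := Var y))(x := Var x)) \<phi>) = inst k ((\<sigma>(y := Var y))(x := t)) \<phi>"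
      using All.prems by (intro All.IH) auto
    moreover have "(\<sigma>(y := Var y))(x := u) = (\<sigma>(x := u))(y := Var y)" for u
      using False by (rule fun_upd_twist[symmetric, OF not_sym])
    ultimately show ?thesis
      using False by (simp only: inst.simps subst.simps if_False)
  next
    case True
    then show ?thesis by (simp only: inst.simps subst.simps if_True simp_thms fun_upd_upd)
  qed
next
  case (Ex y \<phi>)
  show ?case
  proof (cases "y = x")
    case False
    then have "subst x t (inst k ((\<sigma>(y := Var y))(x := Var x)) \<phi>) = inst k ((\<sigma>(y := Var y))(x := t)) \<phi>"
      using Ex.prems by (intro Ex.IH) auto
    moreover have "(\<sigma>(y := Var y))(x := u) = (\<sigma>(x := u))(y := Var y)" for u
      using False by (rule fun_upd_twist[symmetric, OF not_sym])
    ultimately show ?thesis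
      using False by (simp only: inst.simps subst.simps if_False)
  next
    case True
    then show ?thesis by (simp only: inst.simps subst.simps if_True simp_thms fun_upd_upd)
  qed
qed auto

section \<open>Witnessed maximal theories\<close>

locale witnessed_theory =
  fixes G :: "('d, 'f, 'p) fm set"
    and \<psi> :: "('d, 'f, 'p) fm"
    and w :: "nat \<Rightarrow> ('d, 'f, 'p) fm \<Rightarrow> 'd"
  assumes not_prv: "\<not> prv UNIV G \<psi>"
    and maximal: "fv \<alpha> = {} \<Longrightarrow> \<not> prv UNIV G \<alpha> \<Longrightarrow> prv UNIV G (Imp \<alpha> \<psi>)"
    and witness: "fv \<phi> \<subseteq> {x} \<Longrightarrow> prv UNIV G (Imp (Ex x \<phi>) (subst x (Const (w x \<phi>)) \<phi>))"
begin

abbreviation T :: "('d, 'f, 'p) fm \<Rightarrow> bool" where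
  "T \<equiv> prv UNIV G"

lemma T_And: "T (And \<alpha> \<beta>) \<longleftrightarrow> T \<alpha> \<and> T \<beta>"
  using prv_mp[OF prv_mp[OF prv_ax[OF A3]], of G \<alpha> \<beta>] prv_mp[OF prv_ax[OF A4], of G \<alpha> \<beta>]
    prv_mp[OF prv_ax[OF A5], of G \<alpha> \<beta>] by blast

lemma T_Iff: "T (Iff \<alpha> \<beta>) \<Longrightarrow> T \<alpha> \<longleftrightarrow> T \<beta>"
  unfolding T_And using prv_mp[of G \<alpha> \<beta>] prv_mp[of G \<beta> \<alpha>] by blast

text \<open>If both disjuncts failed, \<alpha> \<rightarrow> \<psi> and \<beta> \<rightarrow> \<psi>
  would be theorems and (A8) would prove \<psi>.\<close>

lemma T_Or:
  assumes "fv \<alpha> = {}" "fv \<beta> = {}"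
  shows "T (Or \<alpha> \<beta>) \<longleftrightarrow> T \<alpha> \<or> T \<beta>"
proof
  assume "T (Or \<alpha> \<beta>)"
  then show "T \<alpha> \<or> T \<beta>"
    using maximal[OF assms(1)] maximal[OF assms(2)] not_prv
      prv_mp[OF prv_mp[OF prv_mp[OF prv_ax[OF A8]]], of G \<alpha> \<psi> \<beta>] by blast
next
  assume "T \<alpha> \<or> T \<beta>"
  then show "T (Or \<alpha> \<beta>)"
    using prv_mp[OF prv_ax[OF A6], of G \<alpha> \<beta>] prv_mp[OF prv_ax[OF A7], of G \<beta> \<alpha>] by blast
qed

lemma T_Imp:
  assumes "fv \<alpha> = {}" "fv \<beta> = {}"
  shows "T (Imp \<alpha> \<beta>) \<longleftrightarrow> (T \<alpha> \<longrightarrow> T \<beta>)"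
proof
  assume "T (Imp \<alpha> \<beta>)"
  then show "T \<alpha> \<longrightarrow> T \<beta>"
    using prv_mp[of G \<alpha> \<beta>] by blast
next
  assume "T \<alpha> \<longrightarrow> T \<beta>"
  moreover have "T \<alpha> \<or> T (Imp \<alpha> \<beta>)"
    using prv_ax[OF A9, of G \<alpha> \<beta>] T_Or[of \<alpha> "Imp \<alpha> \<beta>"] assms by simp
  ultimately show "T (Imp \<alpha> \<beta>)"
    using prv_mp[OF prv_ax[OF A1], of G \<beta> \<alpha>] by blast
qed

lemma T_excluded_middle: "fv \<alpha> = {} \<Longrightarrow> T \<alpha> \<or> T (Neg \<alpha>)"
  using prv_ax[OF A10, of G \<alpha>] T_Or[of \<alpha> "Neg \<alpha>"] by simp

lemma T_consistent: "T (Circ \<alpha>) \<Longrightarrow> T \<alpha> \<Longrightarrow> T (Neg \<alpha>) \<Longrightarrow> False"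
  using prv_mp[OF prv_mp[OF prv_mp[OF prv_ax[OF A11]]], of G \<alpha> \<psi>] not_prv by blast

text \<open>One direction is (ci). For the other, a theorem \<circ>\<alpha> would prove \<psi> by
  (A11), so excluded middle leaves \<not>\<circ>\<alpha>.\<close>

lemma T_Neg_Circ: "fv \<alpha> = {} \<Longrightarrow> T (Neg (Circ \<alpha>)) \<longleftrightarrow> T \<alpha> \<and> T (Neg \<alpha>)"
  using prv_mp[OF prv_ax[OF ci], of G \<alpha>] T_And[of \<alpha> "Neg \<alpha>"] T_consistent[of \<alpha>]
    T_excluded_middle[of "Circ \<alpha>"] by auto

lemma T_Circ: "fv \<alpha> = {} \<Longrightarrow> T (Circ \<alpha>) \<longleftrightarrow> \<not> (T \<alpha> \<and> T (Neg \<alpha>))"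
  using T_consistent[of \<alpha>] T_excluded_middle[of "Circ \<alpha>"] T_Neg_Circ[of \<alpha>] by auto

lemma T_Ex:
  assumes "fv \<phi> \<subseteq> {x}"
  shows "T (Ex x \<phi>) \<longleftrightarrow> (\<exists>t. vars_tm t = {} \<and> T (subst x t \<phi>))"
proof
  assume "T (Ex x \<phi>)"
  then have "T (subst x (Const (w x \<phi>)) \<phi>)"
    by (rule prv_mp[OF witness[OF assms]])
  then show "\<exists>t. vars_tm t = {} \<and> T (subst x t \<phi>)"
    by (intro exI[of _ "Const (w x \<phi>)"]) simp
next
  assume "\<exists>t. vars_tm t = {} \<and> T (subst x t \<phi>)"
  then obtain t where "vars_tm t = {}" "T (subst x t \<phi>)"
    by blast
  then show "T (Ex x \<phi>)"
    by (intro prv_mp[OF prv_ax[OF Ax12[OF free_for_closed]]])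
qed

text \<open>Unprovability of \<forall>x\<phi> does give a theorem \<not>\<phi>[x/t], but \<phi>[x/t]
  may be a theorem too. The useful \<open>t\<close> is the witness of \<exists>x(\<phi>
  \<rightarrow> \<forall>x\<phi>): for it, a proof of \<phi>[x/t] is turned into one of
  \<forall>x\<phi>.\<close>

lemma T_All:
  assumes "fv \<phi> \<subseteq> {x}"
  shows "T (All x \<phi>) \<longleftrightarrow> (\<forall>t. vars_tm t = {} \<longrightarrow> T (subst x t \<phi>))"
proof
  assume "T (All x \<phi>)"
  then show "\<forall>t. vars_tm t = {} \<longrightarrow> T (subst x t \<phi>)"
    using prv_mp[OF prv_ax[OF Ax13[OF free_for_closed]]] by auto
next
  assume *: "\<forall>t. vars_tm t = {} \<longrightarrow> T (subst x t \<phi>)"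
  have "\<exists>t. vars_tm t = {} \<and> T (subst x t (Imp \<phi> (All x \<phi>)))"
    using prv_drinker assms by (intro T_Ex[THEN iffD1]) auto
  then show "T (All x \<phi>)"
    using * by (auto dest: prv_mp)
qed

definition tval :: "('d, 'f, 'p) fm \<Rightarrow> tv" where
  "tval \<alpha> = (if \<not> T \<alpha> then Zero else if T (Neg \<alpha>) then Half else One)"

lemma tval_Zero: "tval \<alpha> = Zero \<longleftrightarrow> \<not> T \<alpha>"
  by (simp add: tval_def)

lemma tval_One: "fv \<alpha> = {} \<Longrightarrow> tval \<alpha> = One \<longleftrightarrow> \<not> T (Neg \<alpha>)"
  using T_excluded_middle by (auto simp: tval_def)

lemma tval_binary:
  assumes "fv \<alpha> = {}" "fv \<beta> = {}"
  shows "tval (And \<alpha> \<beta>) = min (tval \<alpha>) (tval \<beta>)"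
    "tval (Or \<alpha> \<beta>) = max (tval \<alpha>) (tval \<beta>)"
    "tval (Imp \<alpha> \<beta>) = tv_imp (tval \<alpha>) (tval \<beta>)"
proof -
  note iffs = tval_Zero tval_One tv_iffs assms
  show "tval (And \<alpha> \<beta>) = min (tval \<alpha>) (tval \<beta>)"
    by (rule tv_eqI) (auto simp: iffs T_And T_Or T_Iff[OF prv_ax[OF neg_and]])
  show "tval (Or \<alpha> \<beta>) = max (tval \<alpha>) (tval \<beta>)"
    by (rule tv_eqI) (auto simp: iffs T_And T_Or T_Iff[OF prv_ax[OF neg_or]])
  show "tval (Imp \<alpha> \<beta>) = tv_imp (tval \<alpha>) (tval \<beta>)"
    by (rule tv_eqI) (auto simp: iffs T_And T_Imp T_Iff[OF prv_ax[OF neg_imp]])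
qed

lemma tval_unary:
  assumes "fv \<alpha> = {}"
  shows "tval (Neg \<alpha>) = tv_neg (tval \<alpha>)" "tval (Circ \<alpha>) = tv_circ (tval \<alpha>)"
proof -
  note iffs = tval_Zero tval_One tv_iffs assms
  show "tval (Neg \<alpha>) = tv_neg (tval \<alpha>)"
    by (rule tv_eqI) (auto simp: iffs T_Iff[OF prv_ax[OF dneg]])
  show "tval (Circ \<alpha>) = tv_circ (tval \<alpha>)"
    by (rule tv_eqI) (auto simp: iffs T_Circ T_Neg_Circ)
qed

text \<open>The term model, transported along \<open>enc\<close> because the type of the domain is
  prescribed; \<open>inv enc\<close> reads the terms back. Original constants pass through
  \<open>k\<close>, so the structure interprets the original language.\<close>

definition term_struct :: "('c \<Rightarrow> 'd) \<Rightarrow> (('d, 'f) tm \<Rightarrow> 'u) \<Rightarrow> ('c, 'f, 'p, 'u) struct" where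
  "term_struct k enc = \<lparr>univ = enc ` {t. vars_tm t = {}}, cint = (\<lambda>c. enc (Const (k c))),
     fint = (\<lambda>f us. enc (Fun f (map (inv enc) us))),
     pint = (\<lambda>P us. tval (Pred P (map (inv enc) us)))\<rparr>"

lemma term_struct_simps:
  "univ (term_struct k enc) = enc ` {t. vars_tm t = {}}"
  "cint (term_struct k enc) c = enc (Const (k c))"
  "fint (term_struct k enc) f us = enc (Fun f (map (inv enc) us))"
  "pint (term_struct k enc) P us = tval (Pred P (map (inv enc) us))"
  by (simp_all add: term_struct_def)

lemma univ_term_struct_nonempty: "univ (term_struct k enc) \<noteq> {}"
proof -
  have "Const undefined \<in> {t. vars_tm t = {}}"
    by simp
  then show ?thesis
    unfolding term_struct_simps(1) by blast
qed

lemma term_struct_is_struct: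
  assumes "inj enc"
  shows "is_struct \<Theta> (term_struct k enc)"
proof -
  have "vars_tm (inv enc u) = {}" if "u \<in> univ (term_struct k enc)" for u
    using that assms by (auto simp: term_struct_simps(1))
  then show ?thesis
    using univ_term_struct_nonempty[of k enc] unfolding is_struct_def
    by (auto simp: term_struct_def subset_iff)
qed

context
  fixes k :: "'c \<Rightarrow> 'd" and enc :: "('d, 'f) tm \<Rightarrow> 'u"
  assumes inj: "inj enc"
begin

lemma eval_tm_term_struct: "eval_tm (term_struct k enc) (enc \<circ> \<sigma>) t = enc (inst_tm k \<sigma> t)"
proof (induction t)
  case (Fun f ts)
  then have "map (eval_tm (term_struct k enc) (enc \<circ> \<sigma>)) ts = map (\<lambda>t. enc (inst_tm k \<sigma> t)) ts"
    by (intro map_cong refl)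
  then show ?case
    by (simp only: eval_tm.simps inst_tm.simps term_struct_simps map_map comp_def inv_f_f[OF inj])
qed (simp_all add: term_struct_simps)

text \<open>Truth lemma. Domain elements are codes of closed terms, so updating the assignment at
  \<open>x\<close> amounts to substituting a closed term for \<open>x\<close>, and the quantifier
  clauses become statements about provable instances and provable negated instances.\<close>

lemma eval_fm_term_struct:
  "(\<And>x. vars_tm (\<sigma> x) = {}) \<Longrightarrow> eval_fm (term_struct k enc) (enc \<circ> \<sigma>) \<phi> = tval (inst k \<sigma> \<phi>)"
proof (induction \<phi> arbitrary: \<sigma>)
  case (Pred P ts)
  show ?case
    by (simp only: eval_fm.simps inst.simps term_struct_simps map_map comp_def
        eval_tm_term_struct[unfolded comp_def] inv_f_f[OF inj])
next
  case (All x \<phi>)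
  let ?\<phi> = "inst k (\<sigma>(x := Var x)) \<phi>"
  have fv: "fv ?\<phi> \<subseteq> {x}"
    using All.prems by (intro fv_inst) auto
  have IH: "eval_fm (term_struct k enc) ((enc \<circ> \<sigma>)(x := enc t)) \<phi> = tval (subst x t ?\<phi>)"
    if "vars_tm t = {}" for t
  proof -
    have "eval_fm (term_struct k enc) (enc \<circ> \<sigma>(x := t)) \<phi> = tval (inst k (\<sigma>(x := t)) \<phi>)"
      using All.prems that by (intro All.IH) auto
    moreover have "enc \<circ> \<sigma>(x := t) = (enc \<circ> \<sigma>)(x := enc t)"
      by auto
    moreover have "subst x t ?\<phi> = inst k (\<sigma>(x := t)) \<phi>"
      using All.prems by (intro subst_inst) auto
    ultimately show ?thesis
      by simp
  qed
  have sub: "fv (subst x t ?\<phi>) = {}" if "vars_tm t = {}" for t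
    using fv fv_subst[of x t ?\<phi>] that by auto
  note q = eval_quant_iff[OF univ_term_struct_nonempty]
  \<comment> \<open>\<forall> has value \<open>One\<close> when its negation is not a theorem;
    (Ax\<not>\<forall>) and a witness for \<not>\<phi> reduce this to single instances.\<close>
  have negs: "T (Neg (All x ?\<phi>)) \<longleftrightarrow> (\<exists>t. vars_tm t = {} \<and> T (Neg (subst x t ?\<phi>)))"
    using T_Iff[OF prv_ax[OF neg_All]] T_Ex[of "Neg ?\<phi>" x] fv by simp
  show ?case
  proof (rule tv_eqI)
    show "eval_fm (term_struct k enc) (enc \<circ> \<sigma>) (All x \<phi>) = Zero \<longleftrightarrow> tval (inst k \<sigma> (All x \<phi>)) = Zero"
      using T_All[OF fv] by (auto simp: q term_struct_simps(1) IH tval_Zero)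
    have "fv (All x ?\<phi>) = {}"
      using fv by auto
    then show "eval_fm (term_struct k enc) (enc \<circ> \<sigma>) (All x \<phi>) = One \<longleftrightarrow> tval (inst k \<sigma> (All x \<phi>)) = One"
      by (auto simp: q term_struct_simps(1) IH tval_One sub negs simp del: fv.simps)
  qed
next
  case (Ex x \<phi>)
  let ?\<phi> = "inst k (\<sigma>(x := Var x)) \<phi>"
  have fv: "fv ?\<phi> \<subseteq> {x}"
    using Ex.prems by (intro fv_inst) auto
  have IH: "eval_fm (term_struct k enc) ((enc \<circ> \<sigma>)(x := enc t)) \<phi> = tval (subst x t ?\<phi>)"
    if "vars_tm t = {}" for t
  proof -
    have "eval_fm (term_struct k enc) (enc \<circ> \<sigma>(x := t)) \<phi> = tval (inst k (\<sigma>(x := t)) \<phi>)"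
      using Ex.prems that by (intro Ex.IH) auto
    moreover have "enc \<circ> \<sigma>(x := t) = (enc \<circ> \<sigma>)(x := enc t)"
      by auto
    moreover have "subst x t ?\<phi> = inst k (\<sigma>(x := t)) \<phi>"
      using Ex.prems by (intro subst_inst) auto
    ultimately show ?thesis
      by simp
  qed
  have sub: "fv (subst x t ?\<phi>) = {}" if "vars_tm t = {}" for t
    using fv fv_subst[of x t ?\<phi>] that by auto
  note q = eval_quant_iff[OF univ_term_struct_nonempty]
  \<comment> \<open>Dually, (Ax\<not>\<exists>) leads to a universal formula, and
    \<open>T_All\<close> is applied to \<not>\<phi>.\<close>
  have negs: "T (Neg (Ex x ?\<phi>)) \<longleftrightarrow> (\<forall>t. vars_tm t = {} \<longrightarrow> T (Neg (subst x t ?\<phi>)))"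
    using T_Iff[OF prv_ax[OF neg_Ex]] T_All[of "Neg ?\<phi>" x] fv by simp
  show ?case
  proof (rule tv_eqI)
    show "eval_fm (term_struct k enc) (enc \<circ> \<sigma>) (Ex x \<phi>) = Zero \<longleftrightarrow> tval (inst k \<sigma> (Ex x \<phi>)) = Zero"
      using T_Ex[OF fv] by (auto simp: q term_struct_simps(1) IH tval_Zero)
    have "fv (Ex x ?\<phi>) = {}"
      using fv by auto
    then show "eval_fm (term_struct k enc) (enc \<circ> \<sigma>) (Ex x \<phi>) = One \<longleftrightarrow> tval (inst k \<sigma> (Ex x \<phi>)) = One"
      by (auto simp: q term_struct_simps(1) IH tval_One sub negs simp del: fv.simps)
  qed
next
  case (And \<alpha> \<beta>)
  show ?case
    by (simp only: inst.simps eval_fm.simps And.IH[OF And.prems]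
        tval_binary fv_inst_closed[OF And.prems])
next
  case (Or \<alpha> \<beta>)
  show ?case
    by (simp only: inst.simps eval_fm.simps Or.IH[OF Or.prems]
        tval_binary fv_inst_closed[OF Or.prems])
next
  case (Imp \<alpha> \<beta>)
  show ?case
    by (simp only: inst.simps eval_fm.simps Imp.IH[OF Imp.prems]
        tval_binary fv_inst_closed[OF Imp.prems])
next
  case (Neg \<alpha>)
  show ?case
    by (simp only: inst.simps eval_fm.simps Neg.IH[OF Neg.prems]
        tval_unary fv_inst_closed[OF Neg.prems])
next
  case (Circ \<alpha>)
  show ?case
    by (simp only: inst.simps eval_fm.simps Circ.IH[OF Circ.prems]
        tval_unary fv_inst_closed[OF Circ.prems])
qed

text \<open>On a sentence every instantiation acts like \<open>Var\<close>, so a single value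
  decides validity, and it is non-zero exactly for theorems.\<close>

lemma valid_in_term_struct:
  assumes "fv \<phi> = {}"
  shows "valid_in (term_struct k enc) \<phi> \<longleftrightarrow> T (inst k Var \<phi>)"
proof -
  have "eval_fm (term_struct k enc) \<mu> \<phi> = tval (inst k Var \<phi>)"
    if "\<mu> \<in> assignments (term_struct k enc)" for \<mu>
  proof -
    have "\<forall>x. \<exists>t. vars_tm t = {} \<and> \<mu> x = enc t"
      using that by (auto simp: assignments_def term_struct_simps(1))
    then obtain \<sigma> where "\<And>x. vars_tm (\<sigma> x) = {}" "\<mu> = enc \<circ> \<sigma>"
      unfolding comp_def by metis
    moreover have "inst k \<sigma> \<phi> = inst k Var \<phi>"
      using assms by (intro inst_cong) auto
    ultimately show ?thesis
      using eval_fm_term_struct by metis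
  qed
  moreover obtain a where "a \<in> univ (term_struct k enc)"
    using univ_term_struct_nonempty[of k enc] by blast
  then have "(\<lambda>_. a) \<in> assignments (term_struct k enc)"
    by (auto simp: assignments_def)
  ultimately show ?thesis
    by (auto simp: valid_in_def tval_Zero)
qed

end

end


section \<open>Coding of Henkin terms by formulas\<close>

primrec code_list :: "('c, 'f, 'p) fm list \<Rightarrow> ('c, 'f, 'p) fm" where
  "code_list [] = Pred undefined []"
| "code_list (\<alpha> # \<alpha>s) = And \<alpha> (code_list \<alpha>s)"

text \<open>Constants are formulas here because each Henkin constant is coded before the term around
  it. The head connective separates the three cases; \<open>undefined\<close> is a fixed padding
  symbol.\<close>

primrec code_tm :: "(('c, 'f, 'p) fm, 'f) tm \<Rightarrow> ('c, 'f, 'p) fm" where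
  "code_tm (Var x) = All x (Pred undefined [])"
| "code_tm (Const \<alpha>) = Neg \<alpha>"
| "code_tm (Fun f ts) = And (Pred undefined [Fun f []]) (code_list (map code_tm ts))"

text \<open>A coded atom is a disjunction whose left side is an atom. No code of a formula is an
  atom, so coded atoms and coded disjunctions cannot be confused.\<close>

primrec code_fm :: "(('c, 'f, 'p) fm, 'f, 'p) fm \<Rightarrow> ('c, 'f, 'p) fm" where
  "code_fm (Pred P ts) = Or (Pred P []) (code_list (map code_tm ts))"
| "code_fm (And \<alpha> \<beta>) = And (code_fm \<alpha>) (code_fm \<beta>)"
| "code_fm (Or \<alpha> \<beta>) = Or (code_fm \<alpha>) (code_fm \<beta>)"
| "code_fm (Imp \<alpha> \<beta>) = Imp (code_fm \<alpha>) (code_fm \<beta>)"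
| "code_fm (Neg \<alpha>) = Neg (code_fm \<alpha>)"
| "code_fm (Circ \<alpha>) = Circ (code_fm \<alpha>)"
| "code_fm (All x \<alpha>) = All x (code_fm \<alpha>)"
| "code_fm (Ex x \<alpha>) = Ex x (code_fm \<alpha>)"

text \<open>The nested recursion first replaces the inner Henkin constants by their codes; the
  resulting formula, with formulas as constants, is then flattened.\<close>

primrec code_hc :: "('c, 'f, 'p) hc \<Rightarrow> ('c, 'f, 'p) fm" where
  "code_hc (Old c) = Pred undefined [Const c]"
| "code_hc (Wit x \<phi>) = Ex x (code_fm (map_fm code_hc id id \<phi>))"

lemma code_list_inj: "code_list \<alpha>s = code_list \<beta>s \<Longrightarrow> \<alpha>s = \<beta>s"
proof (induction \<alpha>s arbitrary: \<beta>s)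
  case Nil
  then show ?case by (cases \<beta>s) auto
next
  case (Cons \<alpha> \<alpha>s)
  then show ?case by (cases \<beta>s) auto
qed

lemma code_tm_inj: "code_tm s = code_tm t \<Longrightarrow> s = t"
proof (induction s arbitrary: t)
  case (Var x)
  then show ?case by (cases t) auto
next
  case (Const c)
  then show ?case by (cases t) auto
next
  case (Fun f ss)
  then obtain ts where t: "t = Fun f ts" and "code_list (map code_tm ss) = code_list (map code_tm ts)"
    by (cases t) auto
  then have "map code_tm ss = map code_tm ts"
    by (intro code_list_inj)
  then have "ss = ts"
    using Fun.IH by (elim list.inj_map_strong[rotated])
  then show ?case by (simp add: t)
qed

lemma code_fm_not_Pred: "code_fm \<phi> \<noteq> Pred P ts" "Pred P ts \<noteq> code_fm \<phi>"
  by (cases \<phi>; simp)+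

lemma code_fm_inj: "code_fm \<phi> = code_fm \<psi> \<Longrightarrow> \<phi> = \<psi>"
proof (induction \<phi> arbitrary: \<psi>)
  case (Pred P ss)
  then obtain ts where \<psi>: "\<psi> = Pred P ts" and "code_list (map code_tm ss) = code_list (map code_tm ts)"
    by (cases \<psi>) (auto simp: code_fm_not_Pred)
  then have "map code_tm ss = map code_tm ts"
    by (intro code_list_inj)
  then have "ss = ts"
    by (rule list.inj_map_strong[rotated]) (rule code_tm_inj)
  then show ?case by (simp add: \<psi>)
next
  case (And \<alpha> \<beta>)
  then show ?case by (cases \<psi>) auto
next
  case (Or \<alpha> \<beta>)
  then show ?case by (cases \<psi>) (auto simp: code_fm_not_Pred)
next
  case (Imp \<alpha> \<beta>)
  then show ?case by (cases \<psi>) auto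
next
  case (Neg \<alpha>)
  then show ?case by (cases \<psi>) auto
next
  case (Circ \<alpha>)
  then show ?case by (cases \<psi>) auto
next
  case (All x \<alpha>)
  then show ?case by (cases \<psi>) auto
next
  case (Ex x \<alpha>)
  then show ?case by (cases \<psi>) auto
qed

lemma code_hc_inj: "code_hc c = code_hc d \<Longrightarrow> c = d"
proof (induction c arbitrary: d)
  case (Old c)
  then show ?case by (cases d) auto
next
  case (Wit x \<phi>)
  then obtain \<psi> where d: "d = Wit x \<psi>" and "map_fm code_hc id id \<phi> = map_fm code_hc id id \<psi>"
    by (cases d) (auto dest: code_fm_inj)
  from this(2) have "\<phi> = \<psi>"
    by (rule fm.inj_map_strong[rotated -1]) (auto intro: Wit.IH)
  then show ?case by (simp add: d)
qed

lemma inj_code: "inj (code_tm \<circ> map_tm code_hc id)"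
proof -
  have "inj (map_tm code_hc (id :: 'f \<Rightarrow> 'f))"
    by (intro tm.inj_map injI code_hc_inj) simp_all
  moreover have "inj code_tm"
    by (intro injI code_tm_inj)
  ultimately show ?thesis
    by (intro inj_compose)
qed


section \<open>Completeness\<close>

definition gen :: "nat list \<Rightarrow> ('c, 'f, 'p) fm \<Rightarrow> ('c, 'f, 'p) fm" where
  "gen xs \<phi> = foldr All xs \<phi>"

lemma fv_gen: "fv (gen xs \<phi>) = fv \<phi> - set xs"
  by (induction xs) (auto simp: gen_def)

lemma ex_closing_list: "\<exists>xs. fv (gen xs \<phi>) = {}"
  using finite_list[OF finite_fv[of \<phi>]] by (auto simp: fv_gen)

lemma prv_gen: "prv UNIV \<Gamma> (gen xs \<phi>) \<longleftrightarrow> prv UNIV \<Gamma> \<phi>"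
  by (induction xs) (auto simp: gen_def prv_All_iff)

text \<open>Validity ranges over all assignments; under a single one the two formulas may differ in
  value. With \<open>prv_All_iff\<close> this lets sentences stand in for open formulas,
  semantically and in the calculus.\<close>

lemma valid_in_All: "univ \<AA> \<noteq> {} \<Longrightarrow> valid_in \<AA> (All x \<phi>) \<longleftrightarrow> valid_in \<AA> \<phi>"
proof
  assume ne: "univ \<AA> \<noteq> {}" and v: "valid_in \<AA> (All x \<phi>)"
  show "valid_in \<AA> \<phi>"
    unfolding valid_in_def
  proof
    fix \<mu>
    assume \<mu>: "\<mu> \<in> assignments \<AA>"
    then have "\<mu> x \<in> univ \<AA>"
      by (auto simp: assignments_def)
    moreover have "eval_fm \<AA> \<mu> (All x \<phi>) \<noteq> Zero"
      using v \<mu> by (simp add: valid_in_def)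
    ultimately have "eval_fm \<AA> (\<mu>(x := \<mu> x)) \<phi> \<noteq> Zero"
      unfolding eval_quant_iff[OF ne] by blast
    then show "eval_fm \<AA> \<mu> \<phi> \<noteq> Zero"
      by simp
  qed
qed (auto simp: valid_in_def eval_quant_iff upd_assignments)

lemma valid_in_gen: "univ \<AA> \<noteq> {} \<Longrightarrow> valid_in \<AA> (gen xs \<phi>) \<longleftrightarrow> valid_in \<AA> \<phi>"
  by (induction xs) (auto simp: gen_def valid_in_All)

lemma inst_gen: "inst k Var (gen xs \<phi>) = gen xs (inst k Var \<phi>)"
  by (induction xs) (auto simp: gen_def)

lemma set1_inst_tm: "set1_tm (inst_tm k Var t) \<subseteq> range k"
  by (induction t) auto

lemma set1_inst: "set1_fm (inst k Var \<phi>) \<subseteq> range k"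
  by (induction \<phi>) (auto dest!: subsetD[OF set1_inst_tm])

text \<open>Clears a derivation of witnesses and of all symbols outside \<Theta>. Foreign constants
  and terms can become a variable, but a foreign atom needs an atom over \<Theta> in its place,
  built from the predicate symbol that \<open>is_signature\<close> grants.\<close>

lemma prv_embed:
  fixes \<Theta> :: "('c, 'f, 'p) signature"
  assumes "is_signature \<Theta>" "\<Gamma> \<union> {\<phi>} \<subseteq> For \<Theta>"
    and "prv UNIV (inst (Old :: 'c \<Rightarrow> ('c, 'f, 'p) hc) Var ` \<Gamma>) (inst Old Var \<phi>)"
  shows "prv (For \<Theta>) \<Gamma> \<phi>"
proof -
  obtain nf pf where pf: "nf \<ge> 1" "pf \<in> pred_syms \<Theta> nf"
    using assms(1) by (auto simp: is_signature_def)
  define cm :: "('c, 'f, 'p) hc \<Rightarrow> 'c option" where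
    "cm = case_hc (\<lambda>c. if c \<in> const_syms \<Theta> then Some c else None) (\<lambda>_ _. None)"
  define okf where "okf = (\<lambda>f n. n \<ge> 1 \<and> f \<in> fun_syms \<Theta> n)"
  define okp where "okp = (\<lambda>P n. n \<ge> 1 \<and> P \<in> pred_syms \<Theta> n)"
  have over_tm: "tm_over \<Theta> (tr_tm cm okf y t)" for y t
    by (induction t) (auto simp: okf_def cm_def list_all_iff split: option.split hc.splits if_splits)
  have "fm_over \<Theta> (tr_fm cm okf okp pf nf y \<psi>)" for y \<psi>
    using pf by (induction \<psi>) (auto simp: okp_def list_all_iff over_tm)
  then have over: "tr_fm cm okf okp pf nf y \<psi> \<in> For \<Theta>" for y \<psi>
    by (simp add: For_def)
  have id_tm: "tr_tm cm okf y (inst_tm Old Var t) = t" if "tm_over \<Theta> t" for y t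
    using that by (induction t) (auto simp: okf_def cm_def list_all_iff map_idI Suc_le_eq)
  have "tr_fm cm okf okp pf nf y (inst Old Var \<psi>) = \<psi>" if "fm_over \<Theta> \<psi>" for y \<psi>
    using that by (induction \<psi>) (auto simp: okp_def list_all_iff map_idI id_tm Suc_le_eq)
  then have id: "tr_fm cm okf okp pf nf y (inst Old Var \<psi>) = \<psi>" if "\<psi> \<in> For \<Theta>" for y \<psi>
    using that by (simp add: For_def)
  obtain V where V: "finite V"
    "\<And>y. y \<notin> V \<Longrightarrow> prv (For \<Theta>) (tr_fm cm okf okp pf nf y ` inst Old Var ` \<Gamma>)
       (tr_fm cm okf okp pf nf y (inst Old Var \<phi>))"
    using tr_prv[OF assms(3) over] by blast
  obtain y where "y \<notin> V"
    using ex_new_if_finite[of V] V(1) by auto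
  moreover have "tr_fm cm okf okp pf nf y ` inst Old Var ` \<Gamma> = \<Gamma>"
    using assms(2) by (force simp: id subset_iff)
  ultimately show ?thesis
    using V(2)[of y] assms(2) by (simp add: id)
qed

lemma completeness:
  fixes \<Theta> :: "('c, 'f, 'p) signature"
  assumes \<Theta>: "is_signature \<Theta>" "\<Gamma> \<union> {\<phi>} \<subseteq> For \<Theta>"
    and not: "\<not> prv (For \<Theta>) \<Gamma> \<phi>"
  shows "\<exists>\<AA> :: ('c, 'f, 'p, ('c, 'f, 'p) fm) struct. is_struct \<Theta> \<AA> \<and> \<not> consequence \<AA> \<Gamma> \<phi>"
proof -
  let ?emb = "inst (Old :: 'c \<Rightarrow> ('c, 'f, 'p) hc) Var :: ('c, 'f, 'p) fm \<Rightarrow> (('c, 'f, 'p) hc, 'f, 'p) fm"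
  \<comment> \<open>Conservativity of the Henkin axioms and the reading of validity in the term
    model concern sentences, so \<phi> is closed here.\<close>
  obtain xs where xs: "fv (gen xs \<phi>) = {}"
    using ex_closing_list by blast
  define \<psi> where "\<psi> = ?emb (gen xs \<phi>)"
  have "fv \<psi> = {}"
    using xs fv_inst[of "gen xs \<phi>" Var "{}" Old] by (simp add: \<psi>_def)
  have "\<not> prv UNIV (?emb ` \<Gamma>) (?emb \<phi>)"
    using prv_embed[OF \<Theta>] not by blast
  then have "\<not> prv UNIV (?emb ` \<Gamma>) \<psi>"
    by (simp add: \<psi>_def inst_gen prv_gen)
  moreover have "set1_fm \<psi> \<subseteq> range Old" and "\<And>\<gamma>. \<gamma> \<in> ?emb ` \<Gamma> \<Longrightarrow> set1_fm \<gamma> \<subseteq> range Old"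
    using set1_inst[of Old] by (auto simp: \<psi>_def)
  ultimately have "\<not> prv UNIV (?emb ` \<Gamma> \<union> henkin_axioms) \<psi>"
    using henkin_conservative[of "?emb ` \<Gamma>" \<psi>] \<open>fv \<psi> = {}\<close> by metis
  then obtain G where G: "?emb ` \<Gamma> \<union> henkin_axioms \<subseteq> G" "\<not> prv UNIV G \<psi>"
    "\<forall>\<alpha>. fv \<alpha> = {} \<longrightarrow> \<not> prv UNIV G \<alpha> \<longrightarrow> prv UNIV G (Imp \<alpha> \<psi>)"
    by (rule lindenbaum)
  interpret witnessed_theory G \<psi> Wit
  proof
    fix x and \<chi> :: "(('c, 'f, 'p) hc, 'f, 'p) fm"
    assume "fv \<chi> \<subseteq> {x}"
    then have "henkin_axiom (x, \<chi>) \<in> G"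
      using G(1) by (auto simp: henkin_axioms_def)
    then show "prv UNIV G (Imp (Ex x \<chi>) (subst x (Const (Wit x \<chi>)) \<chi>))"
      by (intro prv.hyp) (auto simp: henkin_axiom_def)
  qed (use G in auto)
  define \<AA> where "\<AA> = term_struct (Old :: 'c \<Rightarrow> ('c, 'f, 'p) hc)
    (code_tm \<circ> map_tm code_hc id :: _ \<Rightarrow> ('c, 'f, 'p) fm)"
  have st: "is_struct \<Theta> \<AA>"
    unfolding \<AA>_def by (intro term_struct_is_struct inj_code)
  then have ne: "univ \<AA> \<noteq> {}"
    by (simp add: is_struct_def)
  have valid: "valid_in \<AA> \<chi> \<longleftrightarrow> prv UNIV G (?emb \<chi>)" if "fv \<chi> = {}" for \<chi>
    unfolding \<AA>_def using that by (intro valid_in_term_struct inj_code)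
  have "valid_in \<AA> \<gamma>" if "\<gamma> \<in> \<Gamma>" for \<gamma>
  proof -
    obtain ys where "fv (gen ys \<gamma>) = {}"
      using ex_closing_list by blast
    moreover have "prv UNIV G (?emb \<gamma>)"
      using that G(1) by (intro prv.hyp) auto
    ultimately have "valid_in \<AA> (gen ys \<gamma>)"
      by (simp add: valid inst_gen prv_gen)
    then show ?thesis
      by (simp add: valid_in_gen[OF ne])
  qed
  moreover have "\<not> valid_in \<AA> (gen xs \<phi>)"
    using xs G(2) by (simp add: valid \<psi>_def)
  then have "\<not> valid_in \<AA> \<phi>"
    by (simp add: valid_in_gen[OF ne])
  ultimately show ?thesis
    using st by (auto simp: consequence_iff)
qed

text \<open>Soundness covers domains of any type, and an underivable formula is refuted on the type
  of formulas; hence the two conjuncts.\<close>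

theorem theorem14p1:
  fixes \<Theta> :: "('c, 'f, 'p) signature"
    and \<Gamma> :: "('c, 'f, 'p) fm set"
    and \<phi> :: "('c, 'f, 'p) fm"
  assumes "is_signature \<Theta>"
    and "\<Gamma> \<union> {\<phi>} \<subseteq> For \<Theta>"
  shows "QLFI1_derivable \<Theta> \<Gamma> \<phi> \<longleftrightarrow>
    (\<forall>\<AA> :: ('c, 'f, 'p, 'u) struct. is_struct \<Theta> \<AA> \<longrightarrow> consequence \<AA> \<Gamma> \<phi>)
    \<and> (\<forall>\<AA> :: ('c, 'f, 'p, ('c, 'f, 'p) fm) struct. is_struct \<Theta> \<AA> \<longrightarrow> consequence \<AA> \<Gamma> \<phi>)"
proof -
  \<comment> \<open>The domain type is a variable of its own, so that both conjuncts are
    instances.\<close>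
  have "consequence \<AA> \<Gamma> \<phi>" if "prv (For \<Theta>) \<Gamma> \<phi>" "is_struct \<Theta> \<AA>" for \<AA> :: "('c, 'f, 'p, 'v) struct"
    using prv_sound[OF that] by (simp add: consequence_iff)
  then show ?thesis
    using completeness[OF assms] unfolding derivable_iff_prv by metis
qed

end
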